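(* Let $d\ge 2$ and let $(\mathbb{D}_n)_{n\ge1}$ be a sequence of finite subsets of $\mathbb{R}^d$ such that $\lim_{n\to\infty}|\mathbb{D}_n|=\infty$ and $$\liminf_{n\to\infty}\ \mathrm{Sep}(\mathbb{D}_n)\log|\mathbb{D}_n|=\infty .$$ Then $(\mathcal{T}(\mathbb{D}_n)-\log|\mathbb{D}_n|)_{n\ge1}$ converges in distribution, as $n\to\infty$, to the Gumbel distribution, i.e. the distribution with distribution function $z\mapsto\exp(-e^{-z})$, $z\in\mathbb{R}$.
   Context: Fix $d\ge 2$. Let $A(d,1)$ be the set of all (infinite) lines in $\mathbb{R}^d$, and let $B(x,\rho)$ be the closed ball of radius $\rho$ centred at $x$; $o$ is the origin. Let $\mu_{d,1}$ be the unique (locally finite Borel) measure on $A(d,1)$ invariant under rotations, reflections and translations, normalized so that $\mu_{d,1}(\{L\in A(d,1):L\cap B(o,1)\ne\emptyset\})=1$. Let $\Psi$ be a Poisson point process on $A(d,1)\times\mathbb{R}^+$ with intensity measure $\mu_{d,1}\times\lambda_1^+$, where $\lambda_1^+$ is Lebesgue measure on $\mathbb{R}^+$. For a line $L$ let $\mathfrak{c}(L)=\{x\in\mathbb{R}^d:d(x,L)\le 1\}$ ($d(\cdot,\cdot)$ is Euclidean distance). The cover time of a set $A\subset\mathbb{R}^d$ is $$\mathcal{T}(A)=\inf\Bigl\{t>0:A\subset\bigcup_{(L,s)\in\Psi:\,s\le t}\mathfrak{c}(L)\Bigr\}.$$ For a finite set $\mathbb{D}\subset\mathbb{R}^d$,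 $|\mathbb{D}|$ is its cardinality and $\mathrm{Sep}(\mathbb{D})=\inf\{d(x,y):x,y\in\mathbb{D},\,x\ne y\}$ is the minimum separation distance between two points of $\mathbb{D}$. *)

theory Defs
  imports "HOL-Probability.Probability"
begin

definition lines :: "'a::euclidean_space set set" where
  "lines = {L. affine L \<and> aff_dim L = 1}"

text \<open>The topology of \<open>A(d,1)\<close> is the trace of the Fell topology on closed sets. On the space of
  lines it agrees with the usual quotient topology, i.e. the finest one for which
  \<open>(x, v) \<mapsto> {x + t v | t}\<close> with \<open>v \<noteq> 0\<close> is continuous.\<close>

definition line_topology :: "'a::euclidean_space set topology" where
  "line_topology = topology_generated_by
     ({{L \<in> lines. L \<inter> K = {}} |K. compact K} \<union> {{L \<in> lines. L \<inter> U \<noteq> {}} |U. open U})"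

lemma topspace_line_topology [simp]: "topspace line_topology = lines"
proof -
  have "lines \<in> {{L \<in> lines. L \<inter> K = {}} |K::'a set. compact K}"
    by (intro CollectI exI[of _ "{}"]) auto
  then show ?thesis
    unfolding line_topology_def topology_generated_by_topspace by blast
qed

definition line_borel :: "'a::euclidean_space set measure" where
  "line_borel = sigma lines {U. openin line_topology U}"

lemma space_line_borel [simp]: "space line_borel = lines"
  unfolding line_borel_def using openin_subset[of line_topology]
  by (intro space_measure_of) auto

text \<open>The predicate singles out \<open>\<mu>\<^bsub>d,1\<^esub>\<close>. Orthogonal transformations are the rotations and
  reflections about the origin. The maps act on a line \<open>L\<close> by \<open>f ` L\<close>, hence on a set \<open>B\<close> of
  lines by \<open>image f ` B\<close>.\<close>

definition invariant_line_measure :: "'a::euclidean_space set measure \<Rightarrow> bool" where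
  "invariant_line_measure \<mu> \<longleftrightarrow>
     sets \<mu> = sets line_borel \<and>
     (\<forall>L\<in>lines. \<exists>U. openin line_topology U \<and> L \<in> U \<and> emeasure \<mu> U < \<infinity>) \<and>
     (\<forall>f. orthogonal_transformation f \<longrightarrow>
        (\<forall>B\<in>sets \<mu>. emeasure \<mu> (image f ` B) = emeasure \<mu> B)) \<and>
     (\<forall>a. \<forall>B\<in>sets \<mu>. emeasure \<mu> (image (\<lambda>x. a + x) ` B) = emeasure \<mu> B) \<and>
     emeasure \<mu> {L \<in> lines. L \<inter> cball 0 1 \<noteq> {}} = 1"

definition point_count :: "('w \<Rightarrow> 'x set) \<Rightarrow> 'x set \<Rightarrow> 'w \<Rightarrow> ennreal" where
  "point_count \<Psi> B \<omega> = emeasure (count_space UNIV) (\<Psi> \<omega> \<inter> B)"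

text \<open>A Poisson point process with intensity measure \<open>\<nu>\<close>, regarded as a random set of points. This is
  adequate for diffuse \<open>\<nu>\<close>, when the process has almost surely no multiple points.\<close>

definition poisson_point_process :: "'w measure \<Rightarrow> ('w \<Rightarrow> 'x set) \<Rightarrow> 'x measure \<Rightarrow> bool" where
  "poisson_point_process M \<Psi> \<nu> \<longleftrightarrow>
     prob_space M \<and>
     (\<forall>\<omega>\<in>space M. \<Psi> \<omega> \<subseteq> space \<nu>) \<and>
     (\<forall>B\<in>sets \<nu>. point_count \<Psi> B \<in> borel_measurable M) \<and>
     (\<forall>B\<in>sets \<nu>. emeasure \<nu> B < \<infinity> \<longrightarrow>
        (\<forall>k::nat. measure M {\<omega> \<in> space M. point_count \<Psi> B \<omega> = of_nat k}
                  = measure \<nu> B ^ k / fact k * exp (- measure \<nu> B))) \<and>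
     (\<forall>B\<in>sets \<nu>. emeasure \<nu> B = \<infinity> \<longrightarrow> (AE \<omega> in M. point_count \<Psi> B \<omega> = \<infinity>)) \<and>
     (\<forall>(m::nat) B. (\<forall>i<m. B i \<in> sets \<nu>) \<and> disjoint_family_on B {..<m} \<longrightarrow>
        prob_space.indep_vars M (\<lambda>_. borel) (\<lambda>i. point_count \<Psi> (B i)) {..<m})"

definition lebesgue_pos :: "real measure" where
  "lebesgue_pos = restrict_space lborel {0<..}"

definition cylinder :: "'a::euclidean_space set \<Rightarrow> 'a set" where
  "cylinder L = {x. infdist x L \<le> 1}"

text \<open>The infimum is taken in the extended reals, so that the cover time is \<open>\<infinity>\<close> if \<open>A\<close> is
  never covered.\<close>

definition cover_time :: "('a::euclidean_space set \<times> real) set \<Rightarrow> 'a set \<Rightarrow> ereal" where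
  "cover_time \<psi> A =
     Inf {ereal t |t. 0 < t \<and> A \<subseteq> (\<Union>(L, s)\<in>{(L, s) \<in> \<psi>. s \<le> t}. cylinder L)}"

definition Sep :: "'a::metric_space set \<Rightarrow> ereal" where
  "Sep A = Inf {ereal (dist x y) |x y. x \<in> A \<and> y \<in> A \<and> x \<noteq> y}"

definition gumbel :: "real measure" where
  "gumbel = interval_measure (\<lambda>z. exp (- exp (- z)))"

lemma cdf_gumbel: "cdf gumbel = (\<lambda>z. exp (- exp (- z)))"
  unfolding gumbel_def
proof (rule cdf_interval_measure)
  show "((\<lambda>z::real. exp (- exp (- z))) \<longlongrightarrow> 0) at_bot"
    by (intro filterlim_compose[OF exp_at_bot] filterlim_compose[OF filterlim_uminus_at_bot_at_top]
        filterlim_compose[OF exp_at_top] filterlim_uminus_at_top_at_bot)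
qed (auto intro!: continuous_intros)

end

theory Submission
  imports Defs "HOL-Real_Asymp.Real_Asymp"
begin

text \<open>The number \<open>W\<close> of points of \<open>D\<^sub>n\<close> that are uncovered at time \<open>t = log N + z\<close>, \<open>N = |D\<^sub>n|\<close>, has mean
  \<open>e\<^sup>-\<^sup>z\<close>. Being uncovered is the event that the Poisson process misses a certain region, so
  the indicators are positively related and the Chen-Stein method bounds the distance from \<open>W\<close> to a
  Poisson variable by the sum of the covariances of the indicators and of the squares of their means
  alone; no higher moments are needed.

  The covariances are governed by the measure \<open>m(y)\<close> (\<open>overlap y\<close> below) of the lines that hit both \<open>B(o,1)\<close> and \<open>B(y,1)\<close>.
  Rotating \<open>y\<close> gives about \<open>|y|/9\<close> well separated balls, of which a line through \<open>B(o,1)\<close> hits at most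
  two, so \<open>m(y) \<le> 18/|y|\<close>. Since \<open>1 - m\<close> is subadditive, \<open>1 - m(k y) \<le> k (1 - m(y))\<close>, and taking
  \<open>k |y| \<ge> 36\<close> shows that \<open>1 - m(y)\<close> is at least of order \<open>min(1, |y|)\<close>. Pairs at distance more than
  \<open>(log N)\<^sup>2\<close> are controlled by the first bound, the others by the second one together with a packing
  estimate.\<close>

section \<open>Poisson approximation for void events\<close>

text \<open>A bounded counting variable has a polynomial generating function. This form allows
  \<open>q\<close> below to be differentiated term by term.\<close>

lemma (in prob_space) expectation_finite_nat_valued:
  fixes W :: "'a \<Rightarrow> nat" and f :: "nat \<Rightarrow> real"
  assumes W: "W \<in> measurable M (count_space UNIV)" and le: "\<And>\<omega>. \<omega> \<in> space M \<Longrightarrow> W \<omega> \<le> N"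
  shows "expectation (\<lambda>\<omega>. f (W \<omega>)) = (\<Sum>k\<le>N. prob {\<omega> \<in> space M. W \<omega> = k} * f k)"
proof -
  have meas: "{\<omega> \<in> space M. W \<omega> = k} \<in> sets M" for k
    using W by measurable
  have "expectation (\<lambda>\<omega>. f (W \<omega>)) =
      expectation (\<lambda>\<omega>. \<Sum>k\<le>N. f k * indicator {\<omega> \<in> space M. W \<omega> = k} \<omega>)"
  proof (rule Bochner_Integration.integral_cong[OF refl])
    fix \<omega> assume w: "\<omega> \<in> space M"
    have "(\<Sum>k\<le>N. f k * indicator {\<omega> \<in> space M. W \<omega> = k} \<omega>) = (\<Sum>k\<le>N. if k = W \<omega> then f k else 0)"
      using w by (intro sum.cong) (auto simp: indicator_def)
    then show "f (W \<omega>) = (\<Sum>k\<le>N. f k * indicator {\<omega> \<in> space M. W \<omega> = k} \<omega>)"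
      using le[OF w] by (simp add: sum.delta)
  qed
  also have "\<dots> = (\<Sum>k\<le>N. f k * prob {\<omega> \<in> space M. W \<omega> = k})"
    using meas by (subst Bochner_Integration.integral_sum) (auto simp: emeasure_eq_measure)
  finally show ?thesis by (simp add: mult.commute)
qed

text \<open>Factoring out the smaller power leaves \<open>1 - x ^ k\<close>, which is at most
  \<open>k\<close> because it vanishes for \<open>k = 0\<close> and is at most 1 otherwise. It lets
  generating functions be compared through the difference of the counts.\<close>

lemma power_diff_abs_le:
  fixes x :: real
  assumes "0 \<le> x" "x \<le> 1"
  shows "\<bar>x ^ m - x ^ n\<bar> \<le> \<bar>real m - real n\<bar>"
proof -
  have *: "1 - x ^ k \<le> real k" for k
  proof (cases "k = 0")
    case False
    then have "1 \<le> real k" by simp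
    then show ?thesis using zero_le_power[OF assms(1), of k] by linarith
  qed simp
  have **: "\<bar>x ^ m - x ^ n\<bar> \<le> \<bar>real m - real n\<bar>" if "m \<le> n" for m n
  proof -
    have "x ^ m - x ^ n = x ^ m * (1 - x ^ (n - m))"
      using that by (simp add: algebra_simps flip: power_add)
    moreover have "0 \<le> \<dots>" using assms by (simp add: power_le_one)
    moreover have "\<dots> \<le> 1 * (1 - x ^ (n - m))"
      using assms by (intro mult_right_mono) (auto simp: power_le_one)
    ultimately show ?thesis using *[of "n - m"] that by (simp add: of_nat_diff)
  qed
  show ?thesis using **[of m n] **[of n m] by (cases "m \<le> n") (auto simp: abs_minus_commute)
qed

lemma (in prob_space) expectation_indicator_add_sum_diff:
  assumes "A \<in> events" "\<And>j. j \<in> J \<Longrightarrow> B j \<in> events" "\<And>j. j \<in> J \<Longrightarrow> C j \<in> events"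
  shows "expectation (\<lambda>\<omega>. indicat_real A \<omega> + (\<Sum>j\<in>J. indicat_real (B j) \<omega> - indicat_real (C j) \<omega>)) =
    prob A + (\<Sum>j\<in>J. prob (B j) - prob (C j))"
proof -
  have int: "integrable M (indicator E :: _ \<Rightarrow> real)" if "E \<in> events" for E
    using that by (simp add: emeasure_eq_measure)
  have "expectation (\<lambda>\<omega>. indicat_real A \<omega> + (\<Sum>j\<in>J. indicat_real (B j) \<omega> - indicat_real (C j) \<omega>)) =
      expectation (indicat_real A) + expectation (\<lambda>\<omega>. \<Sum>j\<in>J. indicat_real (B j) \<omega> - indicat_real (C j) \<omega>)"
    by (rule Bochner_Integration.integral_add)
      (rule int Bochner_Integration.integrable_sum Bochner_Integration.integrable_diff assms | assumption)+
  also have "expectation (\<lambda>\<omega>. \<Sum>j\<in>J. indicat_real (B j) \<omega> - indicat_real (C j) \<omega>) =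
      (\<Sum>j\<in>J. expectation (\<lambda>\<omega>. indicat_real (B j) \<omega> - indicat_real (C j) \<omega>))"
    by (rule Bochner_Integration.integral_sum)
      (rule int Bochner_Integration.integrable_diff assms | assumption)+
  also have "\<dots> = (\<Sum>j\<in>J. expectation (indicat_real (B j)) - expectation (indicat_real (C j)))"
    by (rule sum.cong[OF refl], rule Bochner_Integration.integral_diff)
      (rule int assms | assumption)+
  finally show ?thesis using assms by simp
qed

definition void :: "'w measure \<Rightarrow> ('w \<Rightarrow> 'x set) \<Rightarrow> 'x set \<Rightarrow> 'w set" where
  "void M \<Psi> B = {\<omega> \<in> space M. \<Psi> \<omega> \<inter> B = {}}"

locale void_process = prob_space M for M :: "'w measure" +
  fixes \<Psi> :: "'w \<Rightarrow> 'x set" and \<nu> :: "'x measure"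
  assumes void_sets: "B \<in> sets \<nu> \<Longrightarrow> void M \<Psi> B \<in> events"
    and prob_void: "B \<in> sets \<nu> \<Longrightarrow> emeasure \<nu> B < \<infinity> \<Longrightarrow> prob (void M \<Psi> B) = exp (- measure \<nu> B)"
begin

lemma void_Un: "void M \<Psi> (A \<union> B) = void M \<Psi> A \<inter> void M \<Psi> B"
  by (auto simp: void_def)

text \<open>Independence of disjoint regions comes for free from the void probabilities.\<close>

lemma expectation_void_mult_prod:
  assumes "finite S" and C: "\<And>j. j \<in> S \<Longrightarrow> C j \<in> fmeasurable \<nu>" "\<And>j. j \<in> S \<Longrightarrow> A \<inter> C j = {}"
    and A: "A \<in> fmeasurable \<nu>"
  shows "expectation (\<lambda>\<omega>. indicator (void M \<Psi> A) \<omega> * (\<Prod>j\<in>S. 1 - \<theta> * indicator (void M \<Psi> (C j)) \<omega>)) =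
    exp (- measure \<nu> A) * expectation (\<lambda>\<omega>. \<Prod>j\<in>S. 1 - \<theta> * indicator (void M \<Psi> (C j)) \<omega>)"
proof -
  have int: "integrable M (\<lambda>\<omega>. indicator (void M \<Psi> B) \<omega> * (\<Prod>j\<in>S. 1 - \<theta> * indicator (void M \<Psi> (C j)) \<omega>))"
    if "B \<in> sets \<nu>" "finite S" "\<And>j. j \<in> S \<Longrightarrow> C j \<in> sets \<nu>" for B S
  proof (rule integrable_const_bound[where B = "\<Prod>j\<in>S. (1 + \<bar>\<theta>\<bar>)"])
    show "AE x in M. norm (indicator (void M \<Psi> B) x *
       (\<Prod>j\<in>S. 1 - \<theta> * indicator (void M \<Psi> (C j)) x)) \<le> (\<Prod>j\<in>S. 1 + \<bar>\<theta>\<bar>)"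
    proof (rule AE_I2)
      fix x
      have "\<bar>\<Prod>j\<in>S. 1 - \<theta> * indicator (void M \<Psi> (C j)) x\<bar> \<le> (\<Prod>j\<in>S. 1 + \<bar>\<theta>\<bar>)"
        unfolding abs_prod by (intro prod_mono) (auto simp: indicator_def)
      moreover have "0 \<le> (\<Prod>j\<in>S. 1 + \<bar>\<theta>\<bar>)" by (intro prod_nonneg) auto
      ultimately show "norm (indicator (void M \<Psi> B) x *
       (\<Prod>j\<in>S. 1 - \<theta> * indicator (void M \<Psi> (C j)) x)) \<le> (\<Prod>j\<in>S. 1 + \<bar>\<theta>\<bar>)"
        by (auto simp: indicator_def)
    qed
    show "(\<lambda>\<omega>. indicator (void M \<Psi> B) \<omega> * (\<Prod>j\<in>S. 1 - \<theta> * indicator (void M \<Psi> (C j)) \<omega>)) \<in> borel_measurable M"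
      using that void_sets by (intro borel_measurable_times borel_measurable_prod borel_measurable_diff) auto
  qed
  \<comment> \<open>The extra region \<open>B\<close> is what the induction needs: expanding a
    factor moves its region \<open>C i\<close> into \<open>B\<close>. The claim itself is the case
    \<open>B = {}\<close>, whose void event is the whole space.\<close>
  have "expectation (\<lambda>\<omega>. indicator (void M \<Psi> (A \<union> B)) \<omega> * (\<Prod>j\<in>S. 1 - \<theta> * indicator (void M \<Psi> (C j)) \<omega>)) =
    exp (- measure \<nu> A) * expectation (\<lambda>\<omega>. indicator (void M \<Psi> B) \<omega> * (\<Prod>j\<in>S. 1 - \<theta> * indicator (void M \<Psi> (C j)) \<omega>))"
    if "B \<in> fmeasurable \<nu>" "A \<inter> B = {}" for B
    using \<open>finite S\<close> C that
  proof (induction S arbitrary: B)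
    case empty
    have [measurable]: "A \<in> sets \<nu>" "B \<in> sets \<nu>" using A empty by auto
    have "measure \<nu> (A \<union> B) = measure \<nu> A + measure \<nu> B"
      using A empty by (intro measure_Un_AE) auto
    moreover have "A \<union> B \<in> fmeasurable \<nu>" using A empty by auto
    ultimately show ?case
      using empty A by (simp add: prob_void void_sets fmeasurable_def exp_add[symmetric])
  next
    case (insert i S)
    let ?P = "\<lambda>\<omega>. \<Prod>j\<in>S. 1 - \<theta> * indicator (void M \<Psi> (C j)) \<omega>"
    have split: "expectation (\<lambda>\<omega>. indicator (void M \<Psi> B) \<omega> * (\<Prod>j\<in>insert i S. 1 - \<theta> * indicator (void M \<Psi> (C j)) \<omega>)) =
        expectation (\<lambda>\<omega>. indicator (void M \<Psi> B) \<omega> * ?P \<omega>) - \<theta> * expectation (\<lambda>\<omega>. indicator (void M \<Psi> (B \<union> C i)) \<omega> * ?P \<omega>)"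
      if B: "B \<in> sets \<nu>" for B
    proof -
      have "(\<lambda>\<omega>. indicator (void M \<Psi> B) \<omega> * (\<Prod>j\<in>insert i S. 1 - \<theta> * indicator (void M \<Psi> (C j)) \<omega>)) =
        (\<lambda>\<omega>. indicator (void M \<Psi> B) \<omega> * ?P \<omega> - \<theta> * (indicator (void M \<Psi> (B \<union> C i)) \<omega> * ?P \<omega>))"
        using insert.hyps by (auto simp: void_Un indicator_inter_arith algebra_simps)
      moreover have "B \<union> C i \<in> sets \<nu>" using B insert.prems by auto
      ultimately show ?thesis
        using B insert.prems(1) insert.hyps
        by (simp add: int Bochner_Integration.integral_diff fmeasurableD)
    qed
    have 1: "A \<union> B \<in> sets \<nu>" "B \<in> sets \<nu>" "B \<union> C i \<in> fmeasurable \<nu>" "A \<inter> (B \<union> C i) = {}"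
      using A insert.prems by auto
    have "A \<union> B \<union> C i = A \<union> (B \<union> C i)" by auto
    then show ?case
      using insert.IH[of B] insert.IH[of "B \<union> C i"] insert.prems 1
      by (simp add: split algebra_simps del: prod.insert)
  qed
  from this[of "{}"] show ?thesis
    by (simp add: void_def cong: Bochner_Integration.integral_cong)
qed

text \<open>With \<open>W\<close> the number of regions missed by the process, \<open>q \<theta> = E (1 - \<theta>)\<^sup>W\<close> satisfies
  \<open>q' = -\<lambda> q\<close> up to an error: given that \<open>A i\<close> is missed, \<open>W - 1\<close> has the law of the number of
  \<open>j \<noteq> i\<close> for which \<open>A j - A i\<close> is missed, which is close to \<open>W\<close>.\<close>

theorem prob_no_void_approx:
  fixes A :: "'i \<Rightarrow> 'x set"
  assumes fin: "finite I" and A: "\<And>i. i \<in> I \<Longrightarrow> A i \<in> fmeasurable \<nu>"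
  shows "\<bar>prob {\<omega> \<in> space M. \<forall>i\<in>I. \<Psi> \<omega> \<inter> A i \<noteq> {}} - exp (- (\<Sum>i\<in>I. exp (- measure \<nu> (A i))))\<bar> \<le>
    (\<Sum>i\<in>I. exp (- measure \<nu> (A i)) ^ 2 +
      (\<Sum>j\<in>I - {i}. exp (- measure \<nu> (A i \<union> A j)) - exp (- measure \<nu> (A i)) * exp (- measure \<nu> (A j))))"
    (is "_ \<le> ?err")
proof -
  define W where "W \<omega> = card {i \<in> I. \<omega> \<in> void M \<Psi> (A i)}" for \<omega>
  define V where "V i \<omega> = card {j \<in> I - {i}. \<omega> \<in> void M \<Psi> (A j - A i)}" for i \<omega>
  define p where "p i = exp (- measure \<nu> (A i))" for i
  define lam where "lam = (\<Sum>i\<in>I. p i)"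
  define N where "N = card I"
  have As: "A i \<in> sets \<nu>" if "i \<in> I" for i using A[OF that] by auto
  have pv: "prob (void M \<Psi> B) = exp (- measure \<nu> B)" if "B \<in> fmeasurable \<nu>" for B
    using that by (auto simp: prob_void fmeasurable_def)
  have W_sum: "real (W \<omega>) = (\<Sum>i\<in>I. indicator (void M \<Psi> (A i)) \<omega>)" for \<omega>
    unfolding W_def using fin by (simp add: indicator_def sum.If_cases Int_def)
  have V_sum: "real (V i \<omega>) = (\<Sum>j\<in>I - {i}. indicator (void M \<Psi> (A j - A i)) \<omega>)" for i \<omega>
    unfolding V_def using fin by (simp add: indicator_def sum.If_cases Int_def)
  have W_le: "W \<omega> \<le> N" for \<omega> unfolding W_def N_def using fin by (intro card_mono) auto
  have V_le: "V i \<omega> \<le> N" for i \<omega> unfolding V_def N_def using fin by (intro card_mono) auto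
  have pw: "(1 - \<theta>) ^ card {j \<in> J. P j} = (\<Prod>j\<in>J. 1 - \<theta> * indicator {j. P j} j)"
    if "finite J" for J :: "'i set" and P and \<theta> :: real
  proof -
    have "(\<Prod>j\<in>J. 1 - \<theta> * indicator {j. P j} j) = (\<Prod>j\<in>J. if P j then 1 - \<theta> else 1)"
      by (intro prod.cong) (auto simp: indicator_def)
    then show ?thesis using that by (simp add: prod.If_cases Int_def)
  qed
  have V_pow: "(1 - \<theta>) ^ V i \<omega> = (\<Prod>j\<in>I - {i}. 1 - \<theta> * indicator (void M \<Psi> (A j - A i)) \<omega>)" for i \<omega> and \<theta> :: real
    unfolding V_def using fin pw[of "I - {i}" \<theta> "\<lambda>j. \<omega> \<in> void M \<Psi> (A j - A i)"] by (simp add: indicator_def)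
  \<comment> \<open>The counts are seen to be measurable as real sums of indicators; taking the
    floor transfers this to natural numbers.\<close>
  have real_meas: "f \<in> measurable M (count_space UNIV)" if "(\<lambda>\<omega>. real (f \<omega>)) \<in> borel_measurable M" for f :: "'w \<Rightarrow> nat"
    using measurable_compose[OF measurable_compose[OF that measurable_real_floor], of nat "count_space UNIV"] by simp
  have W_meas: "W \<in> measurable M (count_space UNIV)"
    by (rule real_meas) (use As void_sets in \<open>auto simp: W_sum intro!: borel_measurable_sum\<close>)
  have V_meas: "V i \<in> measurable M (count_space UNIV)" if "i \<in> I" for i
    by (rule real_meas) (use As that void_sets in \<open>auto simp: V_sum intro!: borel_measurable_sum\<close>)
  have int_W: "integrable M (\<lambda>\<omega>. f (W \<omega>))" for f :: "nat \<Rightarrow> real"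
    using W_meas W_le
    by (intro integrable_const_bound[where B = "Max ((\<lambda>k. \<bar>f k\<bar>) ` {..N})"]) (auto intro!: Max_ge measurable_compose[OF W_meas])
  have int_V: "integrable M (\<lambda>\<omega>. f (V i \<omega>))" if "i \<in> I" for f :: "nat \<Rightarrow> real" and i
    using V_meas[OF that] V_le
    by (intro integrable_const_bound[where B = "Max ((\<lambda>k. \<bar>f k\<bar>) ` {..N})"])
      (auto intro!: Max_ge measurable_compose[OF V_meas[OF that]])
  define q where "q \<theta> = expectation (\<lambda>\<omega>. (1 - \<theta>) ^ W \<omega>)" for \<theta> :: real
  \<comment> \<open>The truncated exponent at \<open>W \<omega> = 0\<close> is harmless, since the
    factor \<open>real (W \<omega>)\<close> vanishes there.\<close>
  define q' where "q' \<theta> = expectation (\<lambda>\<omega>. - (real (W \<omega>) * (1 - \<theta>) ^ (W \<omega> - 1)))" for \<theta> :: real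
  have deriv_q: "(q has_real_derivative q' \<theta>) (at \<theta>)" for \<theta>
    unfolding q_def[abs_def] q'_def
      expectation_finite_nat_valued[OF W_meas W_le, of "\<lambda>k. (1 - _) ^ k"]
      expectation_finite_nat_valued[OF W_meas W_le, of "\<lambda>k. - (real k * (1 - _) ^ (k - 1))"]
    by (auto intro!: derivative_eq_intros sum.cong)
  have q': "q' \<theta> = - (\<Sum>i\<in>I. p i * expectation (\<lambda>\<omega>. (1 - \<theta>) ^ V i \<omega>))" for \<theta>
  proof -
    have int: "integrable M (\<lambda>\<omega>. indicator (void M \<Psi> (A i)) \<omega> * (1 - \<theta>) ^ V i \<omega>)" if "i \<in> I" for i
      using integrable_real_mult_indicator[OF void_sets[OF As[OF that]] int_V[OF that, of "\<lambda>k. (1 - \<theta>) ^ k"]] by (simp add: mult.commute)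
    have "real (W \<omega>) * (1 - \<theta>) ^ (W \<omega> - 1) = (\<Sum>i\<in>I. indicator (void M \<Psi> (A i)) \<omega> * (1 - \<theta>) ^ V i \<omega>)" for \<omega>
    proof -
      \<comment> \<open>Once \<open>A i\<close> is missed, missing \<open>A j\<close> and missing
        \<open>A j - A i\<close> are the same, so the regions other than \<open>A i\<close>
        contribute exactly \<open>V i\<close>.\<close>
      have "W \<omega> - 1 = V i \<omega>" if "i \<in> I" "\<omega> \<in> void M \<Psi> (A i)" for i
      proof -
        have "{j \<in> I. \<omega> \<in> void M \<Psi> (A j)} = insert i {j \<in> I - {i}. \<omega> \<in> void M \<Psi> (A j - A i)}"
          using that by (auto simp: void_def)
        then show ?thesis using fin by (simp add: W_def V_def)
      qed
      then show ?thesis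
        unfolding W_sum sum_distrib_right by (intro sum.cong) (auto simp: indicator_def)
    qed
    then have "q' \<theta> = - (\<Sum>i\<in>I. expectation (\<lambda>\<omega>. indicator (void M \<Psi> (A i)) \<omega> * (1 - \<theta>) ^ V i \<omega>))"
      unfolding q'_def using int by (simp add: Bochner_Integration.integral_sum)
    also have "\<dots> = - (\<Sum>i\<in>I. p i * expectation (\<lambda>\<omega>. (1 - \<theta>) ^ V i \<omega>))"
      unfolding V_pow p_def using fin A
      by (intro arg_cong[where f = uminus] sum.cong refl expectation_void_mult_prod) auto
    finally show ?thesis .
  qed
  \<comment> \<open>Both counts are functions of the same outcome, so their generating functions can
    be compared pointwise before integrating.\<close>
  have coupling: "p i * \<bar>expectation (\<lambda>\<omega>. (1 - \<theta>) ^ W \<omega>) - expectation (\<lambda>\<omega>. (1 - \<theta>) ^ V i \<omega>)\<bar> \<le>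
      p i ^ 2 + (\<Sum>j\<in>I - {i}. exp (- measure \<nu> (A i \<union> A j)) - p i * p j)"
    if i: "i \<in> I" and \<theta>: "0 \<le> \<theta>" "\<theta> \<le> 1" for i \<theta>
  proof -
    let ?I = "\<lambda>j \<omega>. indicator (void M \<Psi> (A j)) \<omega> :: real"
    let ?J = "\<lambda>j \<omega>. indicator (void M \<Psi> (A j - A i)) \<omega> :: real"
    have "\<bar>expectation (\<lambda>\<omega>. (1 - \<theta>) ^ W \<omega>) - expectation (\<lambda>\<omega>. (1 - \<theta>) ^ V i \<omega>)\<bar> =
      \<bar>expectation (\<lambda>\<omega>. (1 - \<theta>) ^ W \<omega> - (1 - \<theta>) ^ V i \<omega>)\<bar>"
      using int_W int_V[OF i] by (subst Bochner_Integration.integral_diff) auto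
    also have "\<dots> \<le> expectation (\<lambda>\<omega>. \<bar>(1 - \<theta>) ^ W \<omega> - (1 - \<theta>) ^ V i \<omega>\<bar>)"
      by (rule integral_abs_bound)
    also have "\<dots> \<le> expectation (\<lambda>\<omega>. ?I i \<omega> + (\<Sum>j\<in>I - {i}. ?J j \<omega> - ?I j \<omega>))"
    proof (rule integral_mono)
      show "integrable M (\<lambda>\<omega>. \<bar>(1 - \<theta>) ^ W \<omega> - (1 - \<theta>) ^ V i \<omega>\<bar>)"
        using int_W int_V[OF i] by auto
      show "integrable M (\<lambda>\<omega>. ?I i \<omega> + (\<Sum>j\<in>I - {i}. ?J j \<omega> - ?I j \<omega>))"
        using i As void_sets by (auto intro!: Bochner_Integration.integrable_sum simp: emeasure_eq_measure)
      fix \<omega>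
      have "\<bar>(1 - \<theta>) ^ W \<omega> - (1 - \<theta>) ^ V i \<omega>\<bar> \<le> \<bar>real (W \<omega>) - real (V i \<omega>)\<bar>"
        using \<theta> by (intro power_diff_abs_le) auto
      also have "real (W \<omega>) - real (V i \<omega>) = ?I i \<omega> - (\<Sum>j\<in>I - {i}. ?J j \<omega> - ?I j \<omega>)"
        unfolding W_sum V_sum using fin i by (simp add: sum.remove sum_subtractf)
      \<comment> \<open>Shrinking \<open>A j\<close> to \<open>A j - A i\<close> enlarges its void
        event, so every summand is nonnegative. This monotonicity is why signed covariances, without
        absolute values, bound the error.\<close>
      also have "\<bar>\<dots>\<bar> \<le> ?I i \<omega> + (\<Sum>j\<in>I - {i}. ?J j \<omega> - ?I j \<omega>)"
      proof -
        have "0 \<le> (\<Sum>j\<in>I - {i}. ?J j \<omega> - ?I j \<omega>)"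
          by (intro sum_nonneg) (auto simp: indicator_def void_def)
        then show ?thesis by (auto simp: indicator_def)
      qed
      finally show "\<bar>(1 - \<theta>) ^ W \<omega> - (1 - \<theta>) ^ V i \<omega>\<bar> \<le> ?I i \<omega> + (\<Sum>j\<in>I - {i}. ?J j \<omega> - ?I j \<omega>)" .
    qed
    also have "\<dots> = p i + (\<Sum>j\<in>I - {i}. exp (- measure \<nu> (A j - A i)) - p j)"
      using i As A
      by (subst expectation_indicator_add_sum_diff)
        (auto intro!: void_sets sum.cong simp: pv p_def fmeasurable_Diff)
    finally have "p i * \<bar>expectation (\<lambda>\<omega>. (1 - \<theta>) ^ W \<omega>) - expectation (\<lambda>\<omega>. (1 - \<theta>) ^ V i \<omega>)\<bar> \<le>
      p i * (p i + (\<Sum>j\<in>I - {i}. exp (- measure \<nu> (A j - A i)) - p j))"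
      by (intro mult_left_mono) (auto simp: p_def)
    also have "\<dots> = p i ^ 2 + (\<Sum>j\<in>I - {i}. exp (- measure \<nu> (A i \<union> A j)) - p i * p j)"
    proof -
      \<comment> \<open>Multiplying by \<open>p i\<close> turns the probability of missing
        \<open>A j\<close> given that \<open>A i\<close> is missed into the joint probability, and
        hence the difference into a covariance.\<close>
      have "p i * exp (- measure \<nu> (A j - A i)) = exp (- measure \<nu> (A i \<union> A j))" if "j \<in> I" for j
      proof -
        have "measure \<nu> (A i \<union> A j) = measure \<nu> (A i) + measure \<nu> (A j - A i)"
          using A[OF i] A[OF that] by (intro measure_Un2)
        then show ?thesis by (simp add: p_def exp_add[symmetric])
      qed
      then have "(\<Sum>j\<in>I - {i}. p i * (exp (- measure \<nu> (A j - A i)) - p j)) =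
          (\<Sum>j\<in>I - {i}. exp (- measure \<nu> (A i \<union> A j)) - p i * p j)"
        by (intro sum.cong refl) (simp add: right_diff_distrib)
      then show ?thesis by (simp add: distrib_left power2_eq_square sum_distrib_left)
    qed
    finally show ?thesis .
  qed
  have ode: "\<bar>q' \<theta> + lam * q \<theta>\<bar> \<le> ?err" if \<theta>: "0 \<le> \<theta>" "\<theta> \<le> 1" for \<theta>
  proof -
    have "q' \<theta> + lam * q \<theta> = (\<Sum>i\<in>I. p i * (expectation (\<lambda>\<omega>. (1 - \<theta>) ^ W \<omega>) - expectation (\<lambda>\<omega>. (1 - \<theta>) ^ V i \<omega>)))"
      by (simp add: q' lam_def q_def sum_distrib_right right_diff_distrib sum_subtractf)
    also have "\<bar>\<dots>\<bar> \<le> (\<Sum>i\<in>I. p i * \<bar>expectation (\<lambda>\<omega>. (1 - \<theta>) ^ W \<omega>) - expectation (\<lambda>\<omega>. (1 - \<theta>) ^ V i \<omega>)\<bar>)"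
      by (rule order_trans[OF sum_abs]) (auto simp: abs_mult p_def)
    also have "\<dots> \<le> (\<Sum>i\<in>I. p i ^ 2 + (\<Sum>j\<in>I - {i}. exp (- measure \<nu> (A i \<union> A j)) - p i * p j))"
      by (intro sum_mono coupling \<theta>)
    finally show ?thesis by (simp add: p_def)
  qed
  \<comment> \<open>Since \<open>0 ^ 0 = 1\<close>, the variable \<open>(1 - 1) ^ W\<close> is the
    indicator of \<open>W = 0\<close>.\<close>
  have q1: "q 1 = prob {\<omega> \<in> space M. \<forall>i\<in>I. \<Psi> \<omega> \<inter> A i \<noteq> {}}"
  proof -
    have "{\<omega> \<in> space M. \<forall>i\<in>I. \<Psi> \<omega> \<inter> A i \<noteq> {}} = {\<omega> \<in> space M. W \<omega> = 0}"
      using fin by (auto simp: W_def void_def)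
    moreover have "q 1 = (\<Sum>k\<le>N. prob {\<omega> \<in> space M. W \<omega> = k} * 0 ^ k)"
      unfolding q_def using expectation_finite_nat_valued[OF W_meas W_le, of "\<lambda>k. (1 - 1) ^ k"] by simp
    moreover have "\<dots> = prob {\<omega> \<in> space M. W \<omega> = 0}"
      by (simp add: power_0_left if_distrib[of "\<lambda>x. _ * x"] cong: if_cong)
    ultimately show ?thesis by simp
  qed
  have "lam \<ge> 0" by (simp add: lam_def p_def sum_nonneg)
  \<comment> \<open>The integrating factor \<open>exp (lam * \<theta>)\<close> reduces the
    approximate equation to one application of the mean value theorem on [0,1]. Dividing by
    \<open>exp lam\<close> at the end leaves a factor at most 1, so the error does not grow with
    \<open>lam\<close>.\<close>
  have "((\<lambda>\<theta>. exp (lam * \<theta>) * q \<theta>) has_real_derivative exp (lam * \<theta>) * (q' \<theta> + lam * q \<theta>)) (at \<theta>)" for \<theta>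
    by (auto intro!: derivative_eq_intros deriv_q simp: algebra_simps)
  then obtain z :: real where z: "0 < z" "z < 1"
    and mvt: "exp (lam * 1) * q 1 - exp (lam * 0) * q 0 = (1 - 0) * (exp (lam * z) * (q' z + lam * q z))"
    using MVT2[of 0 1 "\<lambda>\<theta>. exp (lam * \<theta>) * q \<theta>" "\<lambda>\<theta>. exp (lam * \<theta>) * (q' \<theta> + lam * q \<theta>)"] by auto
  have "q 0 = 1" by (simp add: q_def prob_space)
  then have "q 1 - exp (- lam) = exp (lam * z - lam) * (q' z + lam * q z)"
    using mvt by (simp add: exp_minus exp_diff field_simps)
  moreover have "exp (lam * z - lam) \<le> 1"
    using \<open>lam \<ge> 0\<close> z by (simp add: mult_left_le)
  moreover have "\<bar>q' z + lam * q z\<bar> \<le> ?err" using z by (intro ode) auto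
  ultimately have "\<bar>q 1 - exp (- lam)\<bar> \<le> 1 * ?err"
    by (simp only: abs_mult abs_exp_cancel) (intro mult_mono; simp)
  then show ?thesis by (simp add: q1 lam_def p_def)
qed

end

section \<open>Lines hitting two unit balls\<close>

definition hitting :: "'a::euclidean_space \<Rightarrow> 'a set set" where
  "hitting x = {L \<in> lines. L \<inter> cball x 1 \<noteq> {}}"

lemma linesD:
  assumes "L \<in> lines"
  shows "affine L" "aff_dim L = 1" "closed L" "L \<noteq> {}"
  using assms by (auto simp: lines_def affine_closed)

text \<open>A line is closed, so the distance to it is attained and the bound 1 is witnessed by a
  point of the line in the closed ball.\<close>

lemma mem_cylinder_iff: "L \<in> lines \<Longrightarrow> x \<in> cylinder L \<longleftrightarrow> L \<in> hitting x"
proof -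
  assume L: "L \<in> lines"
  note LD = linesD[OF L]
  have "infdist x L \<le> 1 \<longleftrightarrow> L \<inter> cball x 1 \<noteq> {}"
  proof
    assume "infdist x L \<le> 1"
    moreover obtain y where "y \<in> L" "infdist x L = dist x y"
      using infdist_attains_inf[OF LD(3,4)] by blast
    ultimately show "L \<inter> cball x 1 \<noteq> {}" by auto
  next
    assume "L \<inter> cball x 1 \<noteq> {}"
    then obtain y where "y \<in> L" "dist x y \<le> 1" by auto
    then show "infdist x L \<le> 1" by (meson infdist_le2)
  qed
  then show ?thesis using L by (simp add: cylinder_def hitting_def)
qed

text \<open>Balls are compact here, so the lines that miss one form a subbasic open set of the Fell
  topology.\<close>

lemma hitting_sets: "hitting x \<in> sets line_borel"
proof -
  have o: "openin line_topology {L \<in> lines. L \<inter> cball x 1 = {}}"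
    unfolding line_topology_def by (intro topology_generated_by_Basis) (auto intro!: exI[of _ "cball x 1"])
  have "{L \<in> lines. L \<inter> cball x 1 = {}} \<in> sets line_borel"
    unfolding line_borel_def using o openin_subset[of line_topology] by (subst sets_measure_of) auto
  moreover have "hitting x = space line_borel - {L \<in> lines. L \<inter> cball x 1 = {}}"
    by (auto simp: hitting_def)
  ultimately show ?thesis by (metis sets.compl_sets)
qed

lemma line_param:
  assumes "L \<in> lines" "q \<in> L"
  obtains v where "norm v = 1" "L = range (\<lambda>s. q + s *\<^sub>R v)"
proof -
  note L = linesD[OF assms(1)]
  have "L \<noteq> {q}" using L(2) by auto
  then obtain b where b: "b \<in> L" "b \<noteq> q" using assms(2) by blast
  have "affine hull {q, b} = L"
  proof (rule affine_dim_equal)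
    show "affine hull {q, b} \<subseteq> L" using assms(2) b L(1) by (simp add: hull_minimal)
    show "aff_dim (affine hull {q, b}) = aff_dim L" using b L(2) by (auto simp: aff_dim_affine_hull)
  qed (use L in auto)
  then have L_eq: "L = range (\<lambda>u. q + u *\<^sub>R (b - q))" by (simp add: affine_hull_2_alt)
  define v where "v = (b - q) /\<^sub>R norm (b - q)"
  have "range (\<lambda>u. q + u *\<^sub>R (b - q)) = range (\<lambda>s. q + s *\<^sub>R v)"
  proof (intro subset_antisym image_subsetI)
    fix u show "q + u *\<^sub>R (b - q) \<in> range (\<lambda>s. q + s *\<^sub>R v)"
      using b by (intro image_eqI[where x = "u * norm (b - q)"]) (auto simp: v_def)
    show "q + u *\<^sub>R v \<in> range (\<lambda>u. q + u *\<^sub>R (b - q))"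
      by (intro image_eqI[where x = "u / norm (b - q)"]) (auto simp: v_def divide_inverse)
  qed
  moreover have "norm v = 1" using b by (simp add: v_def)
  ultimately show thesis using that L_eq by metis
qed

text \<open>Write the line as \<open>q + s *\<^sub>R v\<close> with \<open>norm q \<le> 1\<close>. A
  point of it within 1 of \<open>y\<close> is at distance at most 2 from \<open>y\<close> after
  dropping \<open>q\<close>, so |s| differs from \<open>r\<close> by at most 2. Replacing
  \<open>s\<close> by \<open>r\<close> or \<open>- r\<close> costs another 2, and u = r v serves for
  every \<open>y\<close>.\<close>

lemma line_hits_sphere_near_antipodes:
  assumes "L \<in> hitting (0::'a::euclidean_space)"
  obtains u where "\<And>y. norm y = r \<Longrightarrow> L \<in> hitting y \<Longrightarrow> norm (y - u) \<le> 4 \<or> norm (y + u) \<le> 4"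
proof -
  obtain q where q: "L \<in> lines" "q \<in> L" "norm q \<le> 1" using assms by (auto simp: hitting_def)
  obtain v where v: "norm v = 1" "L = range (\<lambda>s. q + s *\<^sub>R v)" using line_param[OF q(1,2)] .
  have "norm (y - r *\<^sub>R v) \<le> 4 \<or> norm (y + r *\<^sub>R v) \<le> 4" if y: "norm y = r" "L \<in> hitting y" for y
  proof -
    obtain s where s: "norm (y - (q + s *\<^sub>R v)) \<le> 1"
      using y v by (auto simp: hitting_def dist_norm)
    have "\<bar>\<bar>s\<bar> - r\<bar> \<le> norm (y - s *\<^sub>R v)"
      using norm_triangle_ineq3[of y "s *\<^sub>R v"] y v by (simp add: abs_minus_commute)
    moreover have 1: "norm (y - s *\<^sub>R v) \<le> 2"
      using norm_triangle_ineq[of "y - (q + s *\<^sub>R v)" q] s q by simp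
    ultimately have 2: "\<bar>\<bar>s\<bar> - r\<bar> \<le> 2" by simp
    show ?thesis
    proof (cases "s \<ge> 0")
      case True
      have "norm (y - r *\<^sub>R v) \<le> norm (y - s *\<^sub>R v) + norm ((s - r) *\<^sub>R v)"
        using norm_triangle_ineq[of "y - s *\<^sub>R v" "(s - r) *\<^sub>R v"] by (simp add: algebra_simps)
      then show ?thesis using 1 2 True v by simp
    next
      case False
      have "norm (y + r *\<^sub>R v) \<le> norm (y - s *\<^sub>R v) + norm ((s + r) *\<^sub>R v)"
        using norm_triangle_ineq[of "y - s *\<^sub>R v" "(s + r) *\<^sub>R v"] by (simp add: algebra_simps)
      moreover have "\<bar>s + r\<bar> \<le> 2" using 2 False by linarith
      ultimately show ?thesis using 1 v by simp
    qed
  qed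
  then show thesis using that by blast
qed

text \<open>Two points in the same ball of radius 4 are at most 8 apart, so each of the two balls
  about the antipodes \<open>u\<close> and \<open>- u\<close> contains at most one of the
  centres.\<close>

lemma card_hit_le_2:
  fixes y :: "nat \<Rightarrow> 'a::euclidean_space"
  assumes "L \<in> hitting 0" and norm: "\<And>k. k \<le> K \<Longrightarrow> norm (y k) = r"
    and sep: "\<And>k l. k \<le> K \<Longrightarrow> l \<le> K \<Longrightarrow> k \<noteq> l \<Longrightarrow> dist (y k) (y l) > 8"
  shows "card {k. k \<le> K \<and> L \<in> hitting (y k)} \<le> 2"
proof -
  obtain u where u: "\<And>y. norm y = r \<Longrightarrow> L \<in> hitting y \<Longrightarrow> norm (y - u) \<le> 4 \<or> norm (y + u) \<le> 4"
    using line_hits_sphere_near_antipodes[OF assms(1)] by blast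
  have 1: "card {k. k \<le> K \<and> dist (y k) w \<le> 4} \<le> 1" for w
  proof -
    have "k = l" if kl: "k \<in> {k. k \<le> K \<and> dist (y k) w \<le> 4}" "l \<in> {k. k \<le> K \<and> dist (y k) w \<le> 4}" for k l
    proof -
      have "dist (y k) (y l) \<le> 8"
        using dist_triangle2[of "y k" "y l" w] kl by simp
      then show ?thesis using sep[of k l] kl by force
    qed
    then show ?thesis by (simp add: card_le_Suc0_iff_eq)
  qed
  have "{k. k \<le> K \<and> L \<in> hitting (y k)} \<subseteq> {k. k \<le> K \<and> dist (y k) u \<le> 4} \<union> {k. k \<le> K \<and> dist (y k) (- u) \<le> 4}"
    using u norm by (auto simp: dist_norm)
  then have "card {k. k \<le> K \<and> L \<in> hitting (y k)} \<le>
      card ({k. k \<le> K \<and> dist (y k) u \<le> 4} \<union> {k. k \<le> K \<and> dist (y k) (- u) \<le> 4})"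
    by (intro card_mono) auto
  also have "\<dots> \<le> card {k. k \<le> K \<and> dist (y k) u \<le> 4} + card {k. k \<le> K \<and> dist (y k) (- u) \<le> 4}"
    by (rule card_Un_le)
  also have "\<dots> \<le> 2" using 1[of u] 1[of "- u"] by simp
  finally show ?thesis .
qed

text \<open>In the plane of two coordinate axes, which exists as d \<ge> 2, the first coordinates
  are the multiples 9k. These alone keep the points 9 > 8 apart; the second coordinate puts them on
  the sphere, and \<open>r \<ge> 9 * real K\<close> makes its square root genuine.\<close>

lemma ex_separated_on_sphere:
  assumes "CARD('d::finite) \<ge> 2" "r \<ge> 9 * real K"
  obtains y :: "nat \<Rightarrow> real ^ 'd" where "\<And>k. k \<le> K \<Longrightarrow> norm (y k) = r"
    "\<And>k l. k \<noteq> l \<Longrightarrow> dist (y k) (y l) > 8"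
proof -
  have "\<not> card (UNIV :: 'd set) \<le> Suc 0" using assms(1) by simp
  then obtain i j :: 'd where ij: "i \<noteq> j"
    by (auto simp: card_le_Suc0_iff_eq)
  define y :: "nat \<Rightarrow> real ^ 'd" where
    "y k = axis i (9 * real k) + axis j (sqrt (r^2 - (9 * real k)^2))" for k
  show thesis
  proof
    fix k assume "k \<le> K"
    then have "9 * real k \<le> r" using assms(2) by linarith
    then have sq: "(9 * real k)^2 \<le> r^2" by (intro power_mono) auto
    have "norm (y k) ^ 2 = (9 * real k)^2 + (sqrt (r^2 - (9 * real k)^2))^2"
      unfolding power2_norm_eq_inner y_def
      using ij by (simp add: inner_add_left inner_add_right inner_axis_axis power2_eq_square)
    also have "\<dots> = r^2" using sq by simp
    finally show "norm (y k) = r"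
      using assms(2) by (auto simp: power2_eq_iff_nonneg)
  next
    fix k l :: nat assume "k \<noteq> l"
    have "(y k - y l) $ i = 9 * (real k - real l)"
      using ij by (simp add: y_def axis_def)
    moreover have "\<bar>(y k - y l) $ i\<bar> \<le> norm (y k - y l)" by (rule component_le_norm_cart)
    moreover have "\<bar>real k - real l\<bar> \<ge> 1" using \<open>k \<noteq> l\<close> by linarith
    ultimately show "dist (y k) (y l) > 8" by (simp add: dist_norm)
  qed
qed

text \<open>Shared by translations and orthogonal maps: a bijection that preserves lines and unit
  balls permutes the sets of hitting lines along with the centres.\<close>

lemma image_hitting_Int:
  assumes bij: "bij f" and lines: "\<And>L. f ` L \<in> lines \<longleftrightarrow> L \<in> lines"
    and cball: "\<And>z. f ` cball z 1 = cball (f z) 1"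
  shows "image f ` (hitting x \<inter> hitting y) = hitting (f x) \<inter> hitting (f y)"
proof -
  have hit: "f ` L \<in> hitting (f z) \<longleftrightarrow> L \<in> hitting z" for L z
  proof -
    have "f ` L \<inter> cball (f z) 1 = f ` (L \<inter> cball z 1)"
      using bij by (simp add: cball[symmetric] bij_def image_Int)
    then show ?thesis by (simp add: hitting_def lines)
  qed
  show ?thesis
  proof (intro subset_antisym subsetI)
    fix L' assume L': "L' \<in> hitting (f x) \<inter> hitting (f y)"
    have "L' = f ` (f -` L')" using bij by (simp add: bij_def surj_image_vimage_eq)
    then show "L' \<in> image f ` (hitting x \<inter> hitting y)"
      using L' hit[of "f -` L'"] by (intro image_eqI[where x = "f -` L'"]) auto
  qed (use hit in auto)
qed

section \<open>The invariant measure of lines: decay and nondegeneracy of the overlap of two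
  balls\<close>

locale line_measure =
  fixes \<mu> :: "(real ^ 'd) set measure"
  assumes inv: "invariant_line_measure \<mu>" and dim: "CARD('d) \<ge> 2"
begin

lemma sets_mu: "sets \<mu> = sets line_borel"
  using inv by (simp add: invariant_line_measure_def)

lemma hitting_in_sets [measurable, simp]: "hitting x \<in> sets \<mu>"
  by (simp add: sets_mu hitting_sets)

lemma translation_invariant:
  "emeasure \<mu> (hitting (a + x) \<inter> hitting (a + y)) = emeasure \<mu> (hitting x \<inter> hitting y)"
proof -
  have "image ((+) a) ` (hitting x \<inter> hitting y) = hitting (a + x) \<inter> hitting (a + y)"
  proof (rule image_hitting_Int)
    show "(+) a ` L \<in> lines \<longleftrightarrow> L \<in> lines" for L
      by (simp only: lines_def mem_Collect_eq aff_dim_translation_eq affine_translation[of L a, symmetric])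
    show "(+) a ` cball z 1 = cball (a + z) 1" for z by (rule cball_translation[symmetric])
    show "bij ((+) a)" by (simp add: bij_def)
  qed
  moreover have "emeasure \<mu> (image ((+) a) ` (hitting x \<inter> hitting y)) = emeasure \<mu> (hitting x \<inter> hitting y)"
    using inv hitting_in_sets unfolding invariant_line_measure_def by blast
  ultimately show ?thesis by simp
qed

lemma orthogonal_invariant:
  assumes f: "orthogonal_transformation f"
  shows "emeasure \<mu> (hitting (f x) \<inter> hitting (f y)) = emeasure \<mu> (hitting x \<inter> hitting y)"
proof -
  have lin: "linear f" "bij f" "linear (inv f)" "bij (inv f)"
    using f orthogonal_transformation_inv[OF f] by (auto simp: orthogonal_transformation_linear orthogonal_transformation_bij)
  have aff: "g ` L \<in> lines" if "linear g" "bij g" "L \<in> lines" for g and L :: "(real ^ 'd) set"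
  proof -
    have "affine (g ` L)"
    proof -
      have "affine hull (g ` L) = g ` (affine hull L)"
        using affine_hull_linear_image[of g L] that(1) by (simp add: linear_conv_bounded_linear)
      also have "affine hull L = L" using linesD(1)[OF that(3)] by (simp only: affine_hull_eq)
      finally show ?thesis by (simp only: affine_hull_eq)
    qed
    then show ?thesis using that by (simp add: lines_def bij_def)
  qed
  have "f ` L \<in> lines \<longleftrightarrow> L \<in> lines" for L
    using aff[of f L] aff[of "inv f" "f ` L"] lin by (auto simp: image_comp o_def bij_is_inj)
  then have "image f ` (hitting x \<inter> hitting y) = hitting (f x) \<inter> hitting (f y)"
    using lin f by (intro image_hitting_Int) (auto simp: image_orthogonal_transformation_cball)
  moreover have "emeasure \<mu> (image f ` (hitting x \<inter> hitting y)) = emeasure \<mu> (hitting x \<inter> hitting y)"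
    using inv f hitting_in_sets unfolding invariant_line_measure_def by blast
  ultimately show ?thesis by simp
qed

lemma emeasure_hitting [simp]: "emeasure \<mu> (hitting x) = 1"
proof -
  have "emeasure \<mu> (hitting 0) = 1"
    using inv unfolding invariant_line_measure_def hitting_def by blast
  then show ?thesis using translation_invariant[of x 0 0] by simp
qed

lemma hitting_fmeasurable [simp]: "hitting x \<in> fmeasurable \<mu>"
  by (simp add: fmeasurable_def)

lemma measure_hitting [simp]: "measure \<mu> (hitting x) = 1"
  by (simp add: measure_def)

definition overlap :: "real ^ 'd \<Rightarrow> real" where
  "overlap y = measure \<mu> (hitting 0 \<inter> hitting y)"

lemma measure_hitting_Int: "measure \<mu> (hitting x \<inter> hitting y) = overlap (y - x)"
  using translation_invariant[of x 0 "y - x"] by (simp add: overlap_def measure_def)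

lemma measure_hitting_Un: "measure \<mu> (hitting x \<union> hitting y) = 2 - overlap (y - x)"
  using measure_Un3[of "hitting x" \<mu> "hitting y"] by (simp add: measure_hitting_Int)

lemma overlap_nonneg: "0 \<le> overlap y" by (simp add: overlap_def)

lemma overlap_orthogonal: "orthogonal_transformation f \<Longrightarrow> overlap (f y) = overlap y"
  using orthogonal_invariant[of f 0 y] by (simp add: overlap_def measure_def orthogonal_transformation_def linear_0)

text \<open>The orthogonal group acts transitively on spheres. This gives all the separated balls in
  the next proof the same overlap with the ball at the origin.\<close>

lemma overlap_norm_cong: "norm x = norm y \<Longrightarrow> overlap x = overlap y"
  by (rule orthogonal_transformation_exists[of x y]) (auto simp: overlap_orthogonal)

text \<open>Double counting: summing the overlaps of the \<open>Suc K\<close> separated balls counts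
  each line through the central ball at most twice, so
  \<open>real (Suc K) * overlap y \<le> 2\<close>. The choice of \<open>K\<close> gives
  \<open>norm y \<le> 9 * real (Suc K)\<close>, whence 18 = 2 * 9.\<close>

lemma overlap_decay: "overlap y * norm y \<le> 18"
proof -
  define r where "r = norm y"
  define K where "K = nat \<lfloor>r / 9\<rfloor>"
  have K: "9 * real K \<le> r" "r \<le> 9 * real (Suc K)"
  proof -
    have "0 \<le> \<lfloor>r / 9\<rfloor>" by (simp add: r_def)
    then have "real K = of_int \<lfloor>r / 9\<rfloor>" by (simp add: K_def)
    then show "9 * real K \<le> r" "r \<le> 9 * real (Suc K)"
      using floor_correct[of "r / 9"] by (simp_all add: field_simps)
  qed
  obtain z :: "nat \<Rightarrow> real ^ 'd" where z: "\<And>k. k \<le> K \<Longrightarrow> norm (z k) = r"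
    "\<And>k l. k \<noteq> l \<Longrightarrow> dist (z k) (z l) > 8"
    using ex_separated_on_sphere[OF dim K(1)] by blast
  have "ennreal (real (Suc K) * overlap y) = (\<Sum>k\<le>K. emeasure \<mu> (hitting 0 \<inter> hitting (z k)))"
  proof -
    have "emeasure \<mu> (hitting 0 \<inter> hitting (z k)) = ennreal (overlap y)" if "k \<le> K" for k
    proof -
      have "overlap (z k) = overlap y" using z(1)[OF that] by (intro overlap_norm_cong) (simp add: r_def)
      moreover have "hitting 0 \<inter> hitting (z k) \<in> fmeasurable \<mu>" by (intro fmeasurable.Int) auto
      ultimately show ?thesis by (simp add: emeasure_eq_measure2 overlap_def)
    qed
    then show ?thesis by (simp add: ennreal_mult overlap_nonneg ennreal_of_nat_eq_real_of_nat)
  qed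
  also have "\<dots> = (\<integral>\<^sup>+ L. (\<Sum>k\<le>K. indicator (hitting 0 \<inter> hitting (z k)) L) \<partial>\<mu>)"
    by (subst nn_integral_sum) auto
  also have "\<dots> \<le> (\<integral>\<^sup>+ L. 2 * indicator (hitting 0) L \<partial>\<mu>)"
  proof (rule nn_integral_mono)
    fix L
    have "(\<Sum>k\<le>K. indicator (hitting 0 \<inter> hitting (z k)) L) = (of_nat (card {k. k \<le> K \<and> L \<in> hitting (z k)}) :: ennreal)"
      if "L \<in> hitting 0"
      using that by (simp add: indicator_def sum.If_cases Int_def)
    moreover have "of_nat (card {k. k \<le> K \<and> L \<in> hitting (z k)}) \<le> (2 :: ennreal)" if "L \<in> hitting 0"
      using of_nat_mono[OF card_hit_le_2[OF that z], of K, where 'a = ennreal] by simp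
    ultimately show "(\<Sum>k\<le>K. indicator (hitting 0 \<inter> hitting (z k)) L) \<le> (2 * indicator (hitting 0) L :: ennreal)"
      by (cases "L \<in> hitting 0") auto
  qed
  also have "\<dots> = ennreal 2" by (simp add: nn_integral_cmult)
  finally have "real (Suc K) * overlap y \<le> 2" by (subst (asm) ennreal_le_iff) auto
  moreover have "overlap y * r \<le> overlap y * (9 * real (Suc K))" using K overlap_nonneg by (intro mult_left_mono) auto
  ultimately show ?thesis by (simp add: r_def algebra_simps)
qed

text \<open>As each ball is hit with measure 1, \<open>1 - overlap (y - x)\<close> is the measure of
  the lines that hit the ball at \<open>x\<close> and miss the one at \<open>y\<close>. A line that
  hits at 0 and misses at \<open>a + b\<close> either misses at \<open>a\<close>, or hits at
  \<open>a\<close> and misses at \<open>a + b\<close>.\<close>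

lemma one_minus_overlap_subadditive: "1 - overlap (a + b) \<le> (1 - overlap a) + (1 - overlap b)"
proof -
  have diff: "measure \<mu> (hitting x - hitting y) = 1 - overlap (y - x)" for x y
    using measure_Diff[of \<mu> "hitting x" "hitting x \<inter> hitting y"]
    by (simp add: measure_hitting_Int Diff_Int)
  have fm: "hitting x - hitting y \<in> fmeasurable \<mu>" for x y by (intro fmeasurable_Diff) auto
  have "measure \<mu> (hitting 0 - hitting (a + b)) \<le> measure \<mu> ((hitting 0 - hitting a) \<union> (hitting a - hitting (a + b)))"
    by (intro measure_mono_fmeasurable fmeasurable.Un fm) auto
  also have "\<dots> \<le> measure \<mu> (hitting 0 - hitting a) + measure \<mu> (hitting a - hitting (a + b))"
    by (rule measure_Un_le) auto
  finally show ?thesis by (simp add: diff)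
qed

lemma one_minus_overlap_scale: "1 - overlap (real k *\<^sub>R y) \<le> real k * (1 - overlap y)"
proof (induction k)
  case 0
  then show ?case by (simp add: overlap_def)
next
  case (Suc k)
  then show ?case using one_minus_overlap_subadditive[of "real k *\<^sub>R y" y] by (simp add: algebra_simps)
qed

text \<open>With k the ceiling of 36/r, the vector k y has norm at least 36, so decay bounds its
  overlap by 18/36 = 1/2. Subadditivity then gives 1/2 \<le> k (1 - m(y)), and k \<le> 36/r + 1
  yields the lower bound r/(2(36 + r)). It increases in r and equals 1/74 at r = 1.\<close>

lemma one_minus_overlap_ge: "1 - overlap y \<ge> min 1 (norm y) / 74"
proof (cases "y = 0")
  case True
  then show ?thesis by (simp add: overlap_def)
next
  case False
  define r where "r = norm y"
  have r: "r > 0" using False by (simp add: r_def)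
  define k where "k = nat \<lceil>36 / r\<rceil>"
  have k: "real k \<ge> 36 / r" "real k \<le> 36 / r + 1"
  proof -
    have "0 \<le> \<lceil>36 / r\<rceil>" using r by (simp add: le_ceiling_iff less_le_trans[of _ 0])
    then have "real k = of_int \<lceil>36 / r\<rceil>" by (simp add: k_def)
    then show "real k \<ge> 36 / r" "real k \<le> 36 / r + 1"
      using ceiling_correct[of "36 / r"] by auto
  qed
  have "real k * r \<ge> 36" using k(1) r by (simp add: field_simps)
  have "overlap (real k *\<^sub>R y) * 36 \<le> overlap (real k *\<^sub>R y) * (real k * r)"
    using \<open>real k * r \<ge> 36\<close> overlap_nonneg by (intro mult_left_mono) auto
  also have "\<dots> \<le> 18" using overlap_decay[of "real k *\<^sub>R y"] by (simp add: r_def)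
  finally have "1 / 2 \<le> real k * (1 - overlap y)" using one_minus_overlap_scale[of k y] by simp
  moreover have "0 \<le> 1 - overlap y"
    using measure_mono_fmeasurable[of "hitting 0 \<inter> hitting y" "hitting 0" \<mu>] by (simp add: overlap_def)
  then have "real k * (1 - overlap y) \<le> (36 / r + 1) * (1 - overlap y)" using k by (intro mult_right_mono) auto
  ultimately have "1 / 2 \<le> (36 / r + 1) * (1 - overlap y)" by linarith
  then have 1: "r / (2 * (36 + r)) \<le> 1 - overlap y"
    using r by (simp add: field_simps)
  have "min 1 r / 74 \<le> r / (2 * (36 + r))"
  proof (cases "r \<le> 1")
    case True
    then have "r / 74 \<le> r / (2 * (36 + r))" using r by (intro divide_left_mono) auto
    then show ?thesis using True by simp
  next
    case False
    then show ?thesis using r by (simp add: field_simps)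
  qed
  then show ?thesis using 1 unfolding r_def by (rule order_trans)
qed

end

section \<open>Separated sets\<close>

text \<open>Volume packing: the open balls of radius \<open>s / 2\<close> about the points are
  disjoint and lie in the ball of radius \<open>r + s / 2\<close> about \<open>x\<close>.\<close>

lemma card_separated_le:
  fixes S :: "'a::euclidean_space set"
  assumes fin: "finite S" and s: "s > 0" and sep: "\<And>y z. y \<in> S \<Longrightarrow> z \<in> S \<Longrightarrow> y \<noteq> z \<Longrightarrow> dist y z \<ge> s"
    and sub: "S \<subseteq> cball x r" and r: "r \<ge> 0"
  shows "real (card S) \<le> (1 + 2 * r / s) ^ DIM('a)"
proof -
  let ?c = "measure lborel (ball (0::'a) 1)"
  have ball: "measure lborel (ball c \<rho>) = \<rho> ^ DIM('a) * ?c" if "\<rho> \<ge> 0" for c :: 'a and \<rho>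
    using content_ball_conv_unit_ball[of \<rho> c] that by simp
  have disj: "disjoint_family_on (\<lambda>y. ball y (s / 2)) S"
  proof (unfold disjoint_family_on_def, intro ballI impI)
    fix y z assume yz: "y \<in> S" "z \<in> S" "y \<noteq> z"
    show "ball y (s / 2) \<inter> ball z (s / 2) = {}"
    proof (rule ccontr)
      assume "ball y (s / 2) \<inter> ball z (s / 2) \<noteq> {}"
      then obtain w where "dist y w < s / 2" "dist z w < s / 2" by auto
      then have "dist y z < s" using dist_triangle2[of y z w] by linarith
      then show False using sep[OF yz] by simp
    qed
  qed
  have "real (card S) * ((s / 2) ^ DIM('a) * ?c) = (\<Sum>y\<in>S. measure lborel (ball y (s / 2)))"
    using s by (simp only: ball[of "s / 2"] sum_constant less_imp_le half_gt_zero)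
  also have "\<dots> = measure lborel (\<Union>y\<in>S. ball y (s / 2))"
  proof (rule measure_finite_Union[symmetric])
    show "emeasure lborel (ball y (s / 2)) \<noteq> \<infinity>" for y :: 'a
      using emeasure_lborel_ball_finite[of y "s / 2"] by simp
  qed (use fin disj in auto)
  also have "\<dots> \<le> measure lborel (ball x (r + s / 2))"
  proof (rule measure_mono_fmeasurable)
    show "(\<Union>y\<in>S. ball y (s / 2)) \<subseteq> ball x (r + s / 2)"
    proof
      fix w assume "w \<in> (\<Union>y\<in>S. ball y (s / 2))"
      then obtain y where y: "y \<in> S" "dist y w < s / 2" by auto
      moreover have "dist x y \<le> r" using sub y by auto
      ultimately show "w \<in> ball x (r + s / 2)" using dist_triangle[of x w y] by simp
    qed
    show "ball x (r + s / 2) \<in> fmeasurable lborel"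
      using emeasure_lborel_ball_finite[of x "r + s / 2"] by (auto intro: fmeasurableI)
    show "(\<Union>y\<in>S. ball y (s / 2)) \<in> sets lborel"
      using fin by (intro sets.finite_UN) auto
  qed
  also have "\<dots> = (r + s / 2) ^ DIM('a) * ?c" using r s by (intro ball) auto
  finally have "real (card S) * (s / 2) ^ DIM('a) * ?c \<le> (r + s / 2) ^ DIM('a) * ?c" by simp
  moreover have "?c > 0" by (simp add: content_ball_pos)
  ultimately have "real (card S) * (s / 2) ^ DIM('a) \<le> (r + s / 2) ^ DIM('a)"
    by (rule mult_right_le_imp_le)
  then have "real (card S) \<le> (r + s / 2) ^ DIM('a) / (s / 2) ^ DIM('a)"
    using s by (simp add: pos_le_divide_eq)
  also have "\<dots> = ((r + s / 2) / (s / 2)) ^ DIM('a)" by (simp only: power_divide)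
  also have "(r + s / 2) / (s / 2) = 1 + 2 * r / s" using s by (simp add: field_simps)
  finally show ?thesis .
qed

text \<open>The power is, up to the factorial, a single term of the exponential series.\<close>

lemma power_le_fact_exp:
  fixes x :: real
  assumes "x \<ge> 0"
  shows "x ^ n \<le> fact n * exp x"
proof -
  have "(\<lambda>n. x ^ n / fact n) sums exp x"
    using exp_converges[of x] by (simp add: divide_inverse mult.commute)
  then have "(\<Sum>k\<in>{n}. x ^ k / fact k) \<le> exp x"
    using assms sum_le_suminf[of "\<lambda>k. x ^ k / fact k" "{n}"]
    by (auto simp: sums_iff)
  then show ?thesis by (simp add: divide_le_eq mult.commute)
qed

text \<open>The points are split into shells of width \<open>s\<close> about \<open>x\<close>. By
  packing, shell k holds polynomially many points in k, each contributing at most exp(-a k s), so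
  the first shell k = 1 dominates. The constant depends on the dimension alone.\<close>

lemma sum_exp_dist_separated_le:
  obtains C :: real where "C > 0"
    "\<And>(S :: 'a::euclidean_space set) x a s. \<lbrakk>finite S; s > 0; a * s \<ge> 3 / 2;
       \<And>y z. y \<in> S \<Longrightarrow> z \<in> S \<Longrightarrow> y \<noteq> z \<Longrightarrow> dist y z \<ge> s; \<And>y. y \<in> S \<Longrightarrow> dist x y \<ge> s\<rbrakk>
       \<Longrightarrow> (\<Sum>y\<in>S. exp (- (a * dist x y))) \<le> C * exp (- (a * s))"
proof -
  let ?d = "DIM('a)"
  \<comment> \<open>Writing 2k + 3 = 4 (k/2 + 3/4) bounds the shell count by a multiple of exp(k/2);
    the value of \<open>C\<close> collects the remaining factors.\<close>
  define C where "C = 4 ^ ?d * fact ?d * exp (3 / 4 :: real)"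
  have "C > 0" by (simp add: C_def)
  have pow: "(2 * real k + 3) ^ ?d \<le> C * exp (real k / 2)" for k
  proof -
    have "(2 * real k + 3) ^ ?d = (4 * ((2 * real k + 3) / 4)) ^ ?d"
      by (rule arg_cong[where f = "\<lambda>x. x ^ ?d"]) (simp add: field_simps)
    also have "\<dots> = 4 ^ ?d * ((2 * real k + 3) / 4) ^ ?d" by (rule power_mult_distrib)
    also have "\<dots> \<le> 4 ^ ?d * (fact ?d * exp ((2 * real k + 3) / 4))"
      by (intro mult_left_mono power_le_fact_exp) auto
    also have "(2 * real k + 3) / 4 = 3 / 4 + real k / 2" by simp
    also have "exp (3 / 4 + real k / 2) = exp (3 / 4) * exp (real k / 2)" by (rule exp_add)
    finally show ?thesis by (simp add: C_def mult.assoc)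
  qed
  have main: "(\<Sum>y\<in>S. exp (- (a * dist x y))) \<le> (2 * C * exp (1 / 2)) * exp (- (a * s))"
    if fin: "finite S" and s: "s > 0" and a: "a * s \<ge> 3 / 2"
      and sep: "\<And>y z. y \<in> S \<Longrightarrow> z \<in> S \<Longrightarrow> y \<noteq> z \<Longrightarrow> dist y z \<ge> s"
      and away: "\<And>y. y \<in> S \<Longrightarrow> dist x y \<ge> s" for S :: "'a set" and x a s
  proof -
    have a0: "a > 0" using a s by (simp add: zero_less_mult_pos2[of a s])
    \<comment> \<open>The shell index. It is at least 1 because no point is closer to
      \<open>x\<close> than \<open>s\<close>; hence the geometric sum starts at \<rho> and retains
      the factor \<open>exp (- (a * s))\<close>.\<close>
    define g where "g y = nat \<lfloor>dist x y / s\<rfloor>" for y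
    have g: "real (g y) * s \<le> dist x y" "dist x y \<le> (real (g y) + 1) * s" "g y \<ge> 1" if "y \<in> S" for y
    proof -
      have "1 \<le> dist x y / s" using away[OF that] s by simp
      then have "1 \<le> \<lfloor>dist x y / s\<rfloor>" by simp
      then show "g y \<ge> 1" unfolding g_def by linarith
      have gr: "real (g y) = of_int \<lfloor>dist x y / s\<rfloor>" unfolding g_def using \<open>1 \<le> \<lfloor>_\<rfloor>\<close> by simp
      have "real (g y) \<le> dist x y / s" "dist x y / s \<le> real (g y) + 1"
        unfolding gr by linarith+
      then show "real (g y) * s \<le> dist x y" "dist x y \<le> (real (g y) + 1) * s"
        using s by (simp_all add: pos_le_divide_eq pos_divide_le_eq)
    qed
    \<comment> \<open>The ratio combines the growth exp(k/2) of the shell counts with the decay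
      exp(-a k s). The hypothesis \<open>a * s \<ge> 3 / 2\<close> makes the exponent at most
      -1.\<close>
    define \<rho> where "\<rho> = exp (1 / 2 - a * s)"
    have \<rho>: "0 < \<rho>" "\<rho> \<le> 1 / 2"
    proof -
      have "\<rho> \<le> exp (- 1)" using a by (simp add: \<rho>_def)
      also have "\<dots> \<le> 1 / 2" using exp_ge_add_one_self[of 1] by (simp add: exp_minus field_simps)
      finally show "\<rho> \<le> 1 / 2" .
    qed (simp add: \<rho>_def)
    have shell: "(\<Sum>y | y \<in> S \<and> g y = k. exp (- (a * dist x y))) \<le> C * \<rho> ^ k" for k
    proof -
      let ?T = "{y \<in> S. g y = k}"
      have "(\<Sum>y\<in>?T. exp (- (a * dist x y))) \<le> (\<Sum>y\<in>?T. exp (- (a * (real k * s))))"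
        using g a0 by (intro sum_mono) auto
      also have "\<dots> = real (card ?T) * exp (- (a * (real k * s)))" by simp
      also have "\<dots> \<le> (C * exp (real k / 2)) * exp (- (a * (real k * s)))"
      proof (rule mult_right_mono)
        have "real (card ?T) \<le> (1 + 2 * ((real k + 1) * s) / s) ^ ?d"
          using fin s sep g(2) by (intro card_separated_le[where x = x]) auto
        also have "1 + 2 * ((real k + 1) * s) / s = 2 * real k + 3" using s by simp
        finally show "real (card ?T) \<le> C * exp (real k / 2)" using pow[of k] by linarith
      qed simp
      also have "\<dots> = C * \<rho> ^ k"
      proof -
        have "\<rho> ^ k = exp (real k * (1 / 2 - a * s))" by (simp only: \<rho>_def exp_of_nat_mult)
        also have "real k * (1 / 2 - a * s) = real k / 2 + - (a * (real k * s))" by (simp add: algebra_simps)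
        finally show ?thesis by (simp only: exp_add mult.assoc)
      qed
      finally show ?thesis .
    qed
    \<comment> \<open>Inserting 1 covers empty \<open>S\<close> and ensures \<open>n \<ge> 1\<close>
      for the geometric sum.\<close>
    define n where "n = Max (insert 1 (g ` S))"
    have img: "g ` S \<subseteq> {1..n}" using g(3) fin by (auto simp: n_def)
    have "(\<Sum>y\<in>S. exp (- (a * dist x y))) = (\<Sum>k\<in>{1..n}. \<Sum>y | y \<in> S \<and> g y = k. exp (- (a * dist x y)))"
      using fin img by (intro sum.group[symmetric]) auto
    also have "\<dots> \<le> (\<Sum>k\<in>{1..n}. C * \<rho> ^ k)" by (intro sum_mono shell)
    also have "\<dots> = C * ((\<rho> - \<rho> ^ Suc n) / (1 - \<rho>))"
    proof -
      have "n \<ge> 1" using fin by (simp add: n_def)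
      then have "(\<Sum>k\<in>{1..n}. \<rho> ^ k) = (\<rho> - \<rho> ^ Suc n) / (1 - \<rho>)"
        using \<rho> by (subst sum_gp) auto
      then show ?thesis by (simp only: sum_distrib_left[symmetric])
    qed
    also have "\<dots> \<le> C * (2 * \<rho>)"
    proof (rule mult_left_mono)
      have "\<rho> * \<rho> \<le> \<rho> * (1 / 2)" using \<rho> by (intro mult_left_mono) auto
      moreover have "0 \<le> \<rho> ^ Suc n" using \<rho> by simp
      ultimately have "\<rho> - \<rho> ^ Suc n \<le> 2 * \<rho> * (1 - \<rho>)"
        by (simp only: right_diff_distrib)
      then show "(\<rho> - \<rho> ^ Suc n) / (1 - \<rho>) \<le> 2 * \<rho>"
        using \<rho> by (subst pos_divide_le_eq) auto
    qed (use \<open>C > 0\<close> in simp)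
    also have "\<dots> = (2 * C * exp (1 / 2)) * exp (- (a * s))"
    proof -
      have "\<rho> = exp (1 / 2) * exp (- (a * s))" unfolding \<rho>_def exp_add[symmetric] by simp
      then show ?thesis by simp
    qed
    finally show ?thesis .
  qed
  show thesis
  proof (rule that)
    show "2 * C * exp (1 / 2) > 0" using \<open>C > 0\<close> by simp
  qed (rule main)
qed

section \<open>The sum of the covariances\<close>

context line_measure begin

text \<open>Beyond distance \<open>R\<close> the overlap is at most 18/R, which makes the covariance
  small relative to the squared mean. Within \<open>R\<close> the squared mean is discarded and
  \<open>one_minus_overlap_ge\<close> is used. The last exponential stays without a restriction on
  \<open>norm y\<close>, so that it can be summed over all points.\<close>

lemma pair_excess_le:
  assumes t: "t > 0" and R: "R > 0"
  shows "exp (- (t * (2 - overlap y))) - exp (- t) ^ 2 \<le>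
    exp (- t) ^ 2 * (exp (18 * t / R) - 1) +
    exp (- t) * ((if norm y \<le> R then exp (- (t / 74)) else 0) + exp (- (t / 74 * norm y)))"
proof -
  have eq: "exp (- (t * (2 - overlap y))) = exp (- t) ^ 2 * exp (t * overlap y)"
    by (simp add: power2_eq_square algebra_simps flip: exp_add)
  have eq': "exp (- (t * (2 - overlap y))) = exp (- t) * exp (- (t * (1 - overlap y)))"
    by (simp add: algebra_simps flip: exp_add)
  have far: "0 \<le> exp (- t) ^ 2 * (exp (18 * t / R) - 1)" using t R by simp
  show ?thesis
  proof (cases "norm y \<le> R")
    case False
    have "overlap y * R \<le> overlap y * norm y" using False overlap_nonneg by (intro mult_left_mono) auto
    also have "\<dots> \<le> 18" by (rule overlap_decay)
    finally have "overlap y \<le> 18 / R" using R by (simp add: pos_le_divide_eq)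
    then have "t * overlap y \<le> 18 * t / R" using mult_left_mono[of "overlap y" "18 / R" t] t by (simp add: mult.commute)
    then have "exp (- t) ^ 2 * (exp (t * overlap y) - 1) \<le> exp (- t) ^ 2 * (exp (18 * t / R) - 1)"
      by (intro mult_left_mono) auto
    moreover have "0 \<le> exp (- t) * (0 + exp (- (t / 74 * norm y)))" by simp
    moreover have "exp (- (t * (2 - overlap y))) - exp (- t) ^ 2 = exp (- t) ^ 2 * (exp (t * overlap y) - 1)"
      unfolding eq by (simp only: right_diff_distrib mult_1_right)
    ultimately show ?thesis using False by (simp only: if_False)
  next
    case True
    have "t * (min 1 (norm y) / 74) \<le> t * (1 - overlap y)"
      using one_minus_overlap_ge t by (intro mult_left_mono) auto
    then have "exp (- (t * (1 - overlap y))) \<le> exp (- (t * (min 1 (norm y) / 74)))" by simp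
    \<comment> \<open>The minimum selects one of the two exponents, so the sum of both exponentials
      dominates.\<close>
    also have "\<dots> \<le> exp (- (t / 74)) + exp (- (t / 74 * norm y))"
      by (cases "norm y \<le> 1") (simp_all add: min_def)
    finally have "exp (- (t * (2 - overlap y))) \<le> exp (- t) * (exp (- (t / 74)) + exp (- (t / 74 * norm y)))"
      unfolding eq' by (intro mult_left_mono) auto
    moreover have "0 \<le> exp (- t) ^ 2" by simp
    ultimately show ?thesis using far True by (simp only: if_True)
  qed
qed

text \<open>The summands are the squared means, the far pairs and the near pairs. Near pairs use
  packing in a ball of radius \<open>R\<close> for the constant exponential and the shell estimate
  for the other. The terms are grouped around \<open>real (card D) * exp (- t)\<close>, the expected
  number of uncovered points, and \<open>C\<close> is uniform in all parameters.\<close>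

lemma sum_pair_excess_le:
  obtains C :: real where "C > 0"
    "\<And>D t R s. \<lbrakk>finite D; t > 0; R > 0; s > 0; t / 74 * s \<ge> 3 / 2;
       \<And>x y. x \<in> D \<Longrightarrow> y \<in> D \<Longrightarrow> x \<noteq> y \<Longrightarrow> dist x y \<ge> s\<rbrakk> \<Longrightarrow>
     (\<Sum>x\<in>D. exp (- t) ^ 2 + (\<Sum>y\<in>D - {x}. exp (- (t * (2 - overlap (y - x)))) - exp (- t) ^ 2)) \<le>
     (real (card D) * exp (- t)) * exp (- t) + (real (card D) * exp (- t)) ^ 2 * (exp (18 * t / R) - 1) +
     (real (card D) * exp (- t)) * ((1 + 2 * R / s) ^ CARD('d) * exp (- (t / 74)) + C * exp (- (t / 74 * s)))"
proof -
  obtain C :: real where C: "C > 0"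
    "\<And>(S :: (real ^ 'd) set) x a s. \<lbrakk>finite S; s > 0; a * s \<ge> 3 / 2;
       \<And>y z. y \<in> S \<Longrightarrow> z \<in> S \<Longrightarrow> y \<noteq> z \<Longrightarrow> dist y z \<ge> s; \<And>y. y \<in> S \<Longrightarrow> dist x y \<ge> s\<rbrakk>
       \<Longrightarrow> (\<Sum>y\<in>S. exp (- (a * dist x y))) \<le> C * exp (- (a * s))"
  proof (rule sum_exp_dist_separated_le)
    fix C :: real
    assume "C > 0" and "\<And>(S :: (real ^ 'd) set) x a s. \<lbrakk>finite S; s > 0; a * s \<ge> 3 / 2;
       \<And>y z. y \<in> S \<Longrightarrow> z \<in> S \<Longrightarrow> y \<noteq> z \<Longrightarrow> dist y z \<ge> s; \<And>y. y \<in> S \<Longrightarrow> dist x y \<ge> s\<rbrakk>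
       \<Longrightarrow> (\<Sum>y\<in>S. exp (- (a * dist x y))) \<le> C * exp (- (a * s))"
    then show thesis by (rule that)
  qed
  show thesis
  proof (rule that[OF C(1)])
    fix D :: "(real ^ 'd) set" and t R s :: real
    assume fin: "finite D" and t: "t > 0" and R: "R > 0" and s: "s > 0" and ts: "t / 74 * s \<ge> 3 / 2"
      and sep: "\<And>x y. x \<in> D \<Longrightarrow> y \<in> D \<Longrightarrow> x \<noteq> y \<Longrightarrow> dist x y \<ge> s"
    let ?N = "real (card D)" and ?p = "exp (- t)" and ?E = "exp (18 * t / R) - 1"
    let ?near = "(1 + 2 * R / s) ^ CARD('d) * exp (- (t / 74))"
    have E: "?E \<ge> 0" using t R by simp
    have inner: "(\<Sum>y\<in>D - {x}. exp (- (t * (2 - overlap (y - x)))) - ?p ^ 2) \<le>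
        ?N * (?p ^ 2 * ?E) + ?p * (?near + C * exp (- (t / 74 * s)))" if x: "x \<in> D" for x
    proof -
      have "(\<Sum>y\<in>D - {x}. exp (- (t * (2 - overlap (y - x)))) - ?p ^ 2) \<le>
        (\<Sum>y\<in>D - {x}. ?p ^ 2 * ?E + ?p * ((if dist x y \<le> R then exp (- (t / 74)) else 0) + exp (- (t / 74 * dist x y))))"
        unfolding dist_norm norm_minus_commute[of x] by (intro sum_mono pair_excess_le t R)
      also have "\<dots> = real (card (D - {x})) * (?p ^ 2 * ?E) +
          ?p * ((\<Sum>y\<in>D - {x}. if dist x y \<le> R then exp (- (t / 74)) else 0) + (\<Sum>y\<in>D - {x}. exp (- (t / 74 * dist x y))))"
        unfolding sum.distrib sum_constant
        by (simp only: sum_distrib_left[symmetric] sum.distrib)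
      also have "\<dots> \<le> ?N * (?p ^ 2 * ?E) + ?p * (?near + C * exp (- (t / 74 * s)))"
      proof (intro add_mono mult_left_mono mult_right_mono)
        show "real (card (D - {x})) \<le> ?N" using fin by (simp add: card_Diff1_le)
        have "(\<Sum>y\<in>D - {x}. if dist x y \<le> R then exp (- (t / 74)) else 0) =
            real (card {y \<in> D - {x}. dist x y \<le> R}) * exp (- (t / 74))"
          using fin by (simp add: sum.If_cases Int_def)
        also have "\<dots> \<le> ?near"
        proof (rule mult_right_mono)
          have "real (card {y \<in> D - {x}. dist x y \<le> R}) \<le> (1 + 2 * R / s) ^ DIM(real ^ 'd)"
            using fin s sep R by (intro card_separated_le[where x = x]) auto
          then show "real (card {y \<in> D - {x}. dist x y \<le> R}) \<le> (1 + 2 * R / s) ^ CARD('d)" by simp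
        qed simp
        finally show "(\<Sum>y\<in>D - {x}. if dist x y \<le> R then exp (- (t / 74)) else 0) \<le> ?near" .
        show "(\<Sum>y\<in>D - {x}. exp (- (t / 74 * dist x y))) \<le> C * exp (- (t / 74 * s))"
          using fin s ts sep x by (intro C(2)) auto
      qed (use E in auto)
      finally show ?thesis .
    qed
    have "(\<Sum>x\<in>D. ?p ^ 2 + (\<Sum>y\<in>D - {x}. exp (- (t * (2 - overlap (y - x)))) - ?p ^ 2)) \<le>
      (\<Sum>x\<in>D. ?p ^ 2 + (?N * (?p ^ 2 * ?E) + ?p * (?near + C * exp (- (t / 74 * s)))))"
      by (intro sum_mono add_left_mono inner)
    also have "\<dots> = ?N * (?p ^ 2 + (?N * (?p ^ 2 * ?E) + ?p * (?near + C * exp (- (t / 74 * s)))))"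
      by (rule sum_constant)
    also have "\<dots> = (?N * ?p) * ?p + (?N * ?p) ^ 2 * ?E + (?N * ?p) * (?near + C * exp (- (t / 74 * s)))"
      by (simp only: power2_eq_square distrib_left mult.assoc mult.left_commute mult.commute add.assoc)
    finally show "(\<Sum>x\<in>D. ?p ^ 2 + (\<Sum>y\<in>D - {x}. exp (- (t * (2 - overlap (y - x)))) - ?p ^ 2)) \<le>
      (?N * ?p) * ?p + (?N * ?p) ^ 2 * ?E + (?N * ?p) * (?near + C * exp (- (t / 74 * s)))" .
  qed
qed

end

text \<open>The preceding bound with t = L + z, R = L^2, s = K/L and mean \<open>exp (- z)\<close>.
  Only the shell term survives, because t s tends to K; its limit becomes small when
  \<open>K\<close> is chosen large.\<close>

lemma error_limit:
  fixes z K C :: real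
  assumes "K > 0"
  shows "((\<lambda>L. exp (- z) * exp (- (L + z)) + exp (- z) ^ 2 * (exp (18 * (L + z) / L ^ 2) - 1) +
    exp (- z) * ((1 + 2 * L ^ 2 / (K / L)) ^ d * exp (- ((L + z) / 74)) + C * exp (- ((L + z) / 74 * (K / L)))))
    \<longlongrightarrow> exp (- z) * C * exp (- (K / 74))) at_top"
proof -
  have 1: "((\<lambda>L. exp (- (L + z))) \<longlongrightarrow> 0) at_top" by real_asymp
  have 2: "((\<lambda>L. exp (18 * (L + z) / L ^ 2) - 1) \<longlongrightarrow> 0) at_top" by real_asymp
  have 3: "((\<lambda>L. (1 + 2 * L ^ 2 / (K / L)) ^ d * exp (- ((L + z) / 74))) \<longlongrightarrow> 0) at_top"
    using assms by real_asymp
  have 4: "((\<lambda>L. exp (- ((L + z) / 74 * (K / L)))) \<longlongrightarrow> exp (- (K / 74))) at_top"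
    using assms by real_asymp
  note tendsto_add[OF tendsto_add[OF tendsto_mult_left[OF 1, of "exp (- z)"] tendsto_mult_left[OF 2, of "exp (- z) ^ 2"]]
    tendsto_mult_left[OF tendsto_add[OF 3 tendsto_mult_left[OF 4, of C]], of "exp (- z)"]]
  then show ?thesis by (simp add: mult.assoc)
qed

section \<open>Cover times\<close>

text \<open>A void event says that the point count is 0, so its probability is the Poisson weight at
  k = 0.\<close>

lemma poisson_imp_void_process:
  assumes P: "poisson_point_process M \<Psi> \<nu>"
  shows "void_process M \<Psi> \<nu>"
proof -
  interpret prob_space M using P by (simp add: poisson_point_process_def)
  have eq: "void M \<Psi> B = {\<omega> \<in> space M. point_count \<Psi> B \<omega> = of_nat 0}" for B
    by (auto simp: void_def point_count_def emeasure_count_space_eq_0)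
  show ?thesis
  proof
    fix B assume B: "B \<in> sets \<nu>"
    then have "point_count \<Psi> B \<in> borel_measurable M"
      using P unfolding poisson_point_process_def by blast
    then show "void M \<Psi> B \<in> events" unfolding eq by measurable
    assume "emeasure \<nu> B < \<infinity>"
    then have "measure M {\<omega> \<in> space M. point_count \<Psi> B \<omega> = of_nat 0} =
        measure \<nu> B ^ 0 / fact 0 * exp (- measure \<nu> B)"
      using P B unfolding poisson_point_process_def by blast
    then show "prob (void M \<Psi> B) = exp (- measure \<nu> B)" unfolding eq by simp
  qed
qed

section \<open>Covering events and cover times of Poisson cylinders\<close>

locale poisson_cylinders =
  line_measure \<mu> + void_process M \<Psi> "\<mu> \<Otimes>\<^sub>M lebesgue_pos"
  for \<mu> :: "(real ^ 'd) set measure" and M :: "'w measure"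
    and \<Psi> :: "'w \<Rightarrow> ((real ^ 'd) set \<times> real) set" +
  assumes points_in_space: "\<omega> \<in> space M \<Longrightarrow> \<Psi> \<omega> \<subseteq> space (\<mu> \<Otimes>\<^sub>M lebesgue_pos)"
begin

text \<open>Phrased through regions of the product space, so that its complement is a union of void
  events and \<open>prob_no_void_approx\<close> applies.\<close>

definition covered :: "(real ^ 'd) set \<Rightarrow> real \<Rightarrow> 'w set" where
  "covered D t = {\<omega> \<in> space M. \<forall>x\<in>D. \<Psi> \<omega> \<inter> hitting x \<times> {0<..t} \<noteq> {}}"

lemma covered_iff:
  assumes "\<omega> \<in> space M"
  shows "\<omega> \<in> covered D t \<longleftrightarrow> D \<subseteq> (\<Union>(L, s)\<in>{(L, s) \<in> \<Psi> \<omega>. s \<le> t}. cylinder L)"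
proof -
  \<comment> \<open>Arrival times are positive, so \<open>s \<le> t\<close> amounts to membership in
    \<open>{0<..t}\<close>; first components are lines, as \<open>mem_cylinder_iff\<close>
    requires.\<close>
  have "\<Psi> \<omega> \<subseteq> lines \<times> {0<..}"
    using points_in_space[OF assms] sets_eq_imp_space_eq[OF sets_mu]
    by (simp add: space_pair_measure lebesgue_pos_def space_restrict_space)
  then have eq: "x \<in> (\<Union>(L, s)\<in>{(L, s) \<in> \<Psi> \<omega>. s \<le> t}. cylinder L) \<longleftrightarrow> \<Psi> \<omega> \<inter> hitting x \<times> {0<..t} \<noteq> {}" for x
    using mem_cylinder_iff[of _ x] by fastforce
  show ?thesis
    using assms by (simp only: covered_def mem_Collect_eq subset_iff eq Ball_def simp_thms)
qed

lemma covered_mono: "s \<le> t \<Longrightarrow> covered D s \<subseteq> covered D t"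
  unfolding covered_def by fastforce

lemma region_sets: "hitting x \<times> {0<..t} \<in> sets (\<mu> \<Otimes>\<^sub>M lebesgue_pos)"
  by (intro pair_measureI) (auto simp: lebesgue_pos_def sets_restrict_space intro!: image_eqI[where x = "{0<..t}"])

lemma covered_events:
  assumes "finite D"
  shows "covered D t \<in> events"
proof -
  have "covered D t = space M - (\<Union>x\<in>D. void M \<Psi> (hitting x \<times> {0<..t}))"
    by (auto simp: covered_def void_def)
  then show ?thesis using assms void_sets[OF region_sets] by (auto intro!: sets.finite_UN)
qed

lemma emeasure_region:
  assumes "H \<in> sets \<mu>" "t > 0"
  shows "emeasure (\<mu> \<Otimes>\<^sub>M lebesgue_pos) (H \<times> {0<..t}) = emeasure \<mu> H * ennreal t"
proof -
  interpret S: sigma_finite_measure lebesgue_pos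
    unfolding lebesgue_pos_def by (intro sigma_finite_measure_restrict_space sigma_finite_lborel) auto
  have "{0<..t} \<in> sets lebesgue_pos"
    by (auto simp: lebesgue_pos_def sets_restrict_space intro!: image_eqI[where x = "{0<..t}"])
  moreover have "emeasure lebesgue_pos {0<..t} = ennreal t"
    unfolding lebesgue_pos_def using assms by (subst emeasure_restrict_space) auto
  ultimately show ?thesis using assms by (simp add: S.emeasure_pair_measure_Times)
qed

lemma measure_region: "t > 0 \<Longrightarrow> measure (\<mu> \<Otimes>\<^sub>M lebesgue_pos) (hitting x \<times> {0<..t}) = t"
  by (simp add: measure_def emeasure_region)

lemma region_fmeasurable: "t > 0 \<Longrightarrow> hitting x \<times> {0<..t} \<in> fmeasurable (\<mu> \<Otimes>\<^sub>M lebesgue_pos)"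
  using region_sets by (auto intro!: fmeasurableI simp: emeasure_region)

lemma measure_region_Un:
  assumes "t > 0"
  shows "measure (\<mu> \<Otimes>\<^sub>M lebesgue_pos) (hitting x \<times> {0<..t} \<union> hitting y \<times> {0<..t}) = t * (2 - overlap (y - x))"
proof -
  have "hitting x \<times> {0<..t} \<union> hitting y \<times> {0<..t} = (hitting x \<union> hitting y) \<times> {0<..t}" by auto
  moreover have "measure (\<mu> \<Otimes>\<^sub>M lebesgue_pos) ((hitting x \<union> hitting y) \<times> {0<..t}) = measure \<mu> (hitting x \<union> hitting y) * t"
    using assms by (simp add: measure_def emeasure_region enn2real_mult)
  ultimately show ?thesis by (simp add: measure_hitting_Un mult.commute)
qed

lemma prob_covered_approx:
  assumes "finite D" "t > 0"
  shows "\<bar>prob (covered D t) - exp (- (real (card D) * exp (- t)))\<bar> \<le>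
    (\<Sum>x\<in>D. exp (- t) ^ 2 + (\<Sum>y\<in>D - {x}. exp (- (t * (2 - overlap (y - x)))) - exp (- t) ^ 2))"
  using prob_no_void_approx[of D "\<lambda>x. hitting x \<times> {0<..t}"] assms
  by (simp add: region_fmeasurable measure_region measure_region_Un power2_eq_square covered_def)

lemma cover_time_le:
  assumes "\<omega> \<in> covered D t" "t > 0"
  shows "cover_time (\<Psi> \<omega>) D \<le> ereal t"
  using assms covered_iff[of \<omega> D t] unfolding cover_time_def
  by (intro Inf_lower) (auto simp: covered_def)

lemma cover_time_nonneg: "0 \<le> cover_time \<psi> D"
  unfolding cover_time_def by (intro Inf_greatest) auto

text \<open>The strict inequality avoids the question whether the infimum is attained.\<close>

lemma cover_time_less_iff:
  assumes "\<omega> \<in> space M"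
  shows "cover_time (\<Psi> \<omega>) D < y \<longleftrightarrow> (\<exists>t>0. ereal t < y \<and> \<omega> \<in> covered D t)"
  unfolding cover_time_def Inf_less_iff by (auto simp: covered_iff[OF assms])

text \<open>Since \<open>covered\<close> increases with time, the covering times below
  \<open>y\<close> may be taken rational, which leaves a countable union of events.\<close>

lemma cover_time_measurable:
  assumes "finite D"
  shows "(\<lambda>\<omega>. cover_time (\<Psi> \<omega>) D) \<in> borel_measurable M"
proof (rule borel_measurableI_less)
  fix y :: ereal
  have "{\<omega> \<in> space M. cover_time (\<Psi> \<omega>) D < y} =
      (\<Union>q\<in>{q :: rat. 0 < q \<and> ereal (real_of_rat q) < y}. covered D (real_of_rat q))"
  proof (intro subset_antisym subsetI)
    fix \<omega> assume "\<omega> \<in> {\<omega> \<in> space M. cover_time (\<Psi> \<omega>) D < y}"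
    then obtain t where t: "t > 0" "ereal t < y" "\<omega> \<in> covered D t"
      using cover_time_less_iff by auto
    obtain q where q: "ereal t < ereal (real_of_rat q)" "ereal (real_of_rat q) < y"
      using ereal_dense3[OF t(2)] by blast
    have "t < real_of_rat q" using q(1) by simp
    then have "0 < real_of_rat q" using t(1) by linarith
    then have "0 < q" by simp
    moreover have "\<omega> \<in> covered D (real_of_rat q)" using covered_mono[of t "real_of_rat q" D] q t by auto
    ultimately show "\<omega> \<in> (\<Union>q\<in>{q :: rat. 0 < q \<and> ereal (real_of_rat q) < y}. covered D (real_of_rat q))"
      using q by blast
  next
    fix \<omega> assume "\<omega> \<in> (\<Union>q\<in>{q :: rat. 0 < q \<and> ereal (real_of_rat q) < y}. covered D (real_of_rat q))"
    then obtain q :: rat where q: "0 < q" "ereal (real_of_rat q) < y" "\<omega> \<in> covered D (real_of_rat q)" by auto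
    then have "\<omega> \<in> space M" by (simp add: covered_def)
    then show "\<omega> \<in> {\<omega> \<in> space M. cover_time (\<Psi> \<omega>) D < y}"
      using q cover_time_less_iff[of \<omega> D y] by (auto intro!: exI[of _ "real_of_rat q"])
  qed
  also have "\<dots> \<in> sets M"
    using covered_events[OF assms] by (intro sets.countable_UN') auto
  finally show "{\<omega> \<in> space M. cover_time (\<Psi> \<omega>) D < y} \<in> sets M" .
qed

text \<open>At time log N + z the mean number of uncovered points is exactly
  \<open>exp (- z)\<close>, so only the error of the Poisson approximation has to vanish. The
  separation scale \<open>K\<close> is fixed first, in terms of \<epsilon>; then n tends to
  infinity.\<close>

lemma prob_covered_limit:
  fixes D :: "nat \<Rightarrow> (real ^ 'd) set"
  assumes fin: "\<And>n. n \<ge> 1 \<Longrightarrow> finite (D n)"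
    and card: "filterlim (\<lambda>n. card (D n)) at_top sequentially"
    and Sep: "liminf (\<lambda>n. Sep (D n) * ereal (ln (real (card (D n))))) = \<infinity>"
  shows "(\<lambda>n. prob (covered (D n) (ln (real (card (D n))) + z))) \<longlonglongrightarrow> exp (- exp (- z))"
proof -
  define L where "L n = ln (real (card (D n)))" for n
  have L: "filterlim L at_top sequentially"
    unfolding L_def
    by (rule filterlim_compose[OF ln_at_top filterlim_compose[OF filterlim_real_sequentially card]])
  obtain C :: real where C: "C > 0"
    "\<And>D t R s. \<lbrakk>finite D; t > 0; R > 0; s > 0; t / 74 * s \<ge> 3 / 2;
       \<And>x y. x \<in> D \<Longrightarrow> y \<in> D \<Longrightarrow> x \<noteq> y \<Longrightarrow> dist x y \<ge> s\<rbrakk> \<Longrightarrow>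
     (\<Sum>x\<in>D. exp (- t) ^ 2 + (\<Sum>y\<in>D - {x}. exp (- (t * (2 - overlap (y - x)))) - exp (- t) ^ 2)) \<le>
     (real (card D) * exp (- t)) * exp (- t) + (real (card D) * exp (- t)) ^ 2 * (exp (18 * t / R) - 1) +
     (real (card D) * exp (- t)) * ((1 + 2 * R / s) ^ CARD('d) * exp (- (t / 74)) + C * exp (- (t / 74 * s)))"
  proof (rule sum_pair_excess_le)
    fix C :: real
    assume "C > 0" and "\<And>D t R s. \<lbrakk>finite D; t > 0; R > 0; s > 0; t / 74 * s \<ge> 3 / 2;
       \<And>x y. x \<in> D \<Longrightarrow> y \<in> D \<Longrightarrow> x \<noteq> y \<Longrightarrow> dist x y \<ge> s\<rbrakk> \<Longrightarrow>
     (\<Sum>x\<in>D. exp (- t) ^ 2 + (\<Sum>y\<in>D - {x}. exp (- (t * (2 - overlap (y - x)))) - exp (- t) ^ 2)) \<le>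
     (real (card D) * exp (- t)) * exp (- t) + (real (card D) * exp (- t)) ^ 2 * (exp (18 * t / R) - 1) +
     (real (card D) * exp (- t)) * ((1 + 2 * R / s) ^ CARD('d) * exp (- (t / 74)) + C * exp (- (t / 74 * s)))"
    then show thesis by (rule that)
  qed
  have "eventually (\<lambda>n. \<bar>prob (covered (D n) (L n + z)) - exp (- exp (- z))\<bar> < \<epsilon>) sequentially"
    if "\<epsilon> > 0" for \<epsilon> :: real
  proof -
    have "((\<lambda>K. exp (- z) * C * exp (- (K / 74))) \<longlongrightarrow> 0) at_top" by real_asymp
    then have "eventually (\<lambda>K. exp (- z) * C * exp (- (K / 74)) < \<epsilon>) at_top"
      using \<open>\<epsilon> > 0\<close> by (rule order_tendstoD)
    \<comment> \<open>The exponent t/74 * s tends to K/74; with 222 = 3 * 74 this limit is at least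
      3, so the required bound 3/2 holds eventually.\<close>
    then have "eventually (\<lambda>K. exp (- z) * C * exp (- (K / 74)) < \<epsilon> \<and> K \<ge> 222) at_top"
      using eventually_ge_at_top by (rule eventually_conj)
    then obtain K :: real where K: "exp (- z) * C * exp (- (K / 74)) < \<epsilon>" "K \<ge> 222"
      using eventually_happens'[OF trivial_limit_at_top_linorder] by blast
    define err where "err l = exp (- z) * exp (- (l + z)) + exp (- z) ^ 2 * (exp (18 * (l + z) / l ^ 2) - 1) +
      exp (- z) * ((1 + 2 * l ^ 2 / (K / l)) ^ CARD('d) * exp (- ((l + z) / 74)) + C * exp (- ((l + z) / 74 * (K / l))))" for l
    have "(err \<longlongrightarrow> exp (- z) * C * exp (- (K / 74))) at_top"
      unfolding err_def using K(2) by (intro error_limit) auto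
    then have "eventually (\<lambda>l. err l < \<epsilon>) at_top" using K(1) by (rule order_tendstoD)
    then have ev1: "eventually (\<lambda>n. err (L n) < \<epsilon>) sequentially"
      by (rule eventually_compose_filterlim[OF _ L])
    have "((\<lambda>l. (l + z) / 74 * (K / l)) \<longlongrightarrow> K / 74) at_top" using K(2) by real_asymp
    then have "eventually (\<lambda>l. 3 / 2 < (l + z) / 74 * (K / l)) at_top"
      by (rule order_tendstoD) (use K(2) in auto)
    then have ev2: "eventually (\<lambda>n. 3 / 2 < (L n + z) / 74 * (K / L n)) sequentially"
      by (rule eventually_compose_filterlim[OF _ L])
    have ev3: "eventually (\<lambda>n. max 0 (- z) < L n) sequentially"
      using L by (simp only: filterlim_at_top_dense)
    have ev4: "eventually (\<lambda>n. ereal K < Sep (D n) * ereal (L n)) sequentially"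
      unfolding L_def by (rule less_LiminfD) (simp add: Sep)
    have ev5: "eventually (\<lambda>n. n \<ge> 1 \<and> card (D n) \<ge> 1) sequentially"
      using card by (intro eventually_conj eventually_ge_at_top) (simp only: filterlim_at_top)
    show ?thesis
      using ev1 ev2 ev3 ev4 ev5
    proof eventually_elim
      case (elim n)
      let ?t = "L n + z"
      have fin': "finite (D n)" using fin elim by simp
      have pos: "L n > 0" "?t > 0" using elim by auto
      have Np: "real (card (D n)) * exp (- ?t) = exp (- z)"
      proof -
        have "real (card (D n)) > 0" using elim(5) by simp
        moreover from this have "exp (L n) = real (card (D n))" by (simp add: L_def)
        moreover have "exp (- ?t) = exp (- z) / exp (L n)" by (simp add: exp_diff[symmetric])
        ultimately show ?thesis by simp
      qed
      have sep: "dist x y \<ge> K / L n" if "x \<in> D n" "y \<in> D n" "x \<noteq> y" for x y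
      proof -
        have "Sep (D n) \<le> ereal (dist x y)"
          unfolding Sep_def using that by (intro Inf_lower) auto
        then have "Sep (D n) * ereal (L n) \<le> ereal (dist x y) * ereal (L n)"
          using pos by (intro ereal_mult_right_mono) auto
        with elim(4) have "ereal K < ereal (dist x y) * ereal (L n)" by (rule less_le_trans)
        then have "K < dist x y * L n" by simp
        then show ?thesis using pos by (simp add: pos_divide_le_eq)
      qed
      have "\<bar>prob (covered (D n) ?t) - exp (- (real (card (D n)) * exp (- ?t)))\<bar> \<le>
        (\<Sum>x\<in>D n. exp (- ?t) ^ 2 + (\<Sum>y\<in>D n - {x}. exp (- (?t * (2 - overlap (y - x)))) - exp (- ?t) ^ 2))"
        by (rule prob_covered_approx[OF fin' pos(2)])
      also have "\<dots> \<le> (real (card (D n)) * exp (- ?t)) * exp (- ?t) +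
        (real (card (D n)) * exp (- ?t)) ^ 2 * (exp (18 * ?t / (L n) ^ 2) - 1) +
        (real (card (D n)) * exp (- ?t)) * ((1 + 2 * (L n) ^ 2 / (K / L n)) ^ CARD('d) * exp (- (?t / 74)) + C * exp (- (?t / 74 * (K / L n))))"
        using fin' pos K(2) elim(2) sep by (intro C(2)) auto
      also have "\<dots> = err (L n)" unfolding Np err_def ..
      also have "\<dots> < \<epsilon>" by (rule elim(1))
      finally show ?case unfolding Np .
    qed
  qed
  then show ?thesis unfolding tendsto_iff dist_real_def L_def by blast
qed

end

text \<open>Passes from covering probabilities to distribution functions. The shift from
  \<open>z\<close> to \<open>y > z\<close> allows for an infimum that is not attained and is removed
  by continuity of \<open>G\<close>. The term \<open>1 - P b n\<close> allows for sets not covered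
  by a late time and is made small by large \<open>b\<close>.\<close>

lemma tendsto_sandwich_shifted:
  fixes F :: "nat \<Rightarrow> real" and G :: "real \<Rightarrow> real" and P :: "real \<Rightarrow> nat \<Rightarrow> real"
  assumes P: "\<And>z. P z \<longlonglongrightarrow> G z" and cont: "isCont G z" and top: "(G \<longlongrightarrow> 1) at_top"
    and lower: "eventually (\<lambda>n. P z n \<le> F n) sequentially"
    and upper: "\<And>y b. y > z \<Longrightarrow> eventually (\<lambda>n. F n \<le> P y n + (1 - P b n)) sequentially"
  shows "F \<longlonglongrightarrow> G z"
proof (rule order_tendstoI)
  fix a assume "a < G z"
  then have "eventually (\<lambda>n. a < P z n) sequentially" by (rule order_tendstoD[OF P])
  with lower show "eventually (\<lambda>n. a < F n) sequentially" by eventually_elim simp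
next
  fix a assume a: "G z < a"
  define \<epsilon> where "\<epsilon> = (a - G z) / 2"
  have \<epsilon>: "\<epsilon> > 0" using a by (simp add: \<epsilon>_def)
  have "(G \<longlongrightarrow> G z) (at_right z)" using cont by (simp add: isCont_def filterlim_at_split)
  then have "eventually (\<lambda>y. G y < G z + \<epsilon>) (at_right z)" by (rule order_tendstoD) (use \<epsilon> in simp)
  moreover have "eventually (\<lambda>y. y > z) (at_right z)" by (rule eventually_at_right_less)
  ultimately have "eventually (\<lambda>y. G y < G z + \<epsilon> \<and> y > z) (at_right z)" by (rule eventually_conj)
  then obtain y where y: "G y < G z + \<epsilon>" "y > z"
    using eventually_happens'[OF trivial_limit_at_right_real] by blast
  have "eventually (\<lambda>b. 1 - \<epsilon> < G b) at_top" by (rule order_tendstoD[OF top]) (use \<epsilon> in simp)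
  then obtain b where b: "1 - \<epsilon> < G b"
    using eventually_happens'[OF trivial_limit_at_top_linorder] by blast
  have "(\<lambda>n. P y n + (1 - P b n)) \<longlonglongrightarrow> G y + (1 - G b)" by (intro tendsto_intros P)
  moreover have "G y + (1 - G b) < a" using y b by (simp add: \<epsilon>_def field_simps)
  ultimately have "eventually (\<lambda>n. P y n + (1 - P b n) < a) sequentially" by (rule order_tendstoD)
  with upper[OF y(2), of b] show "eventually (\<lambda>n. F n < a) sequentially" by eventually_elim simp
qed

theorem theorem1p2:
  fixes \<mu> :: "(real ^ 'd) set measure"
    and M :: "'w measure"
    and \<Psi> :: "'w \<Rightarrow> ((real ^ 'd) set \<times> real) set"
    and D :: "nat \<Rightarrow> (real ^ 'd) set"
  assumes "CARD('d) \<ge> 2"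
    and "invariant_line_measure \<mu>"
    and "poisson_point_process M \<Psi> (\<mu> \<Otimes>\<^sub>M lebesgue_pos)"
    and "\<And>n. n \<ge> 1 \<Longrightarrow> finite (D n)"
    and "filterlim (\<lambda>n. card (D n)) at_top sequentially"
    and "liminf (\<lambda>n. Sep (D n) * ereal (ln (real (card (D n))))) = \<infinity>"
  shows "weak_conv_m
           (\<lambda>n. distr M borel
              (\<lambda>\<omega>. real_of_ereal (cover_time (\<Psi> \<omega>) (D n)) - ln (real (card (D n)))))
           gumbel"
proof -
  interpret void_process M \<Psi> "\<mu> \<Otimes>\<^sub>M lebesgue_pos"
    using assms(3) by (rule poisson_imp_void_process)
  interpret poisson_cylinders \<mu> M \<Psi>
  proof
    show "\<Psi> \<omega> \<subseteq> space (\<mu> \<Otimes>\<^sub>M lebesgue_pos)" if "\<omega> \<in> space M" for \<omega>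
      using assms(3) that unfolding poisson_point_process_def by blast
  qed (use assms in auto)
  define L where "L n = ln (real (card (D n)))" for n
  have L: "filterlim L at_top sequentially"
    unfolding L_def
    by (rule filterlim_compose[OF ln_at_top filterlim_compose[OF filterlim_real_sequentially assms(5)]])
  define T where "T n \<omega> = cover_time (\<Psi> \<omega>) (D n)" for n \<omega>
  define G :: "real \<Rightarrow> real" where "G z = exp (- exp (- z))" for z
  have T_meas: "T n \<in> borel_measurable M" if "n \<ge> 1" for n
    unfolding T_def using assms(4)[OF that] by (rule cover_time_measurable)
  have cdf: "cdf (distr M borel (\<lambda>\<omega>. real_of_ereal (T n \<omega>) - L n)) z =
      prob {\<omega> \<in> space M. real_of_ereal (T n \<omega>) - L n \<le> z}" if "n \<ge> 1" for n z
  proof -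
    have "(\<lambda>\<omega>. real_of_ereal (T n \<omega>) - L n) \<in> borel_measurable M" using T_meas[OF that] by measurable
    then show ?thesis
      by (simp add: cdf_def measure_distr vimage_def Int_def conj_commute)
  qed
  have "(\<lambda>n. cdf (distr M borel (\<lambda>\<omega>. real_of_ereal (T n \<omega>) - L n)) z) \<longlonglongrightarrow> G z" for z
  proof (rule tendsto_sandwich_shifted[where G = G and P = "\<lambda>z n. prob (covered (D n) (L n + z))"])
    show "(\<lambda>n. prob (covered (D n) (L n + z))) \<longlonglongrightarrow> G z" for z
      unfolding L_def G_def using assms(4-6) by (rule prob_covered_limit)
    show "isCont G z" unfolding G_def by (intro continuous_intros)
    show "(G \<longlongrightarrow> 1) at_top" unfolding G_def by real_asymp
    have ev: "eventually (\<lambda>n. n \<ge> 1 \<and> L n + y > 0) sequentially" for y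
    proof (rule eventually_conj)
      have "eventually (\<lambda>n. - y < L n) sequentially" using L by (simp only: filterlim_at_top_dense)
      then show "eventually (\<lambda>n. L n + y > 0) sequentially" by eventually_elim simp
    qed (rule eventually_ge_at_top)
    have events: "{\<omega> \<in> space M. real_of_ereal (T n \<omega>) - L n \<le> z} \<in> events" if "n \<ge> 1" for n
      using T_meas[OF that] by measurable
    show "eventually (\<lambda>n. prob (covered (D n) (L n + z)) \<le>
        cdf (distr M borel (\<lambda>\<omega>. real_of_ereal (T n \<omega>) - L n)) z) sequentially"
      using ev[of z]
    proof eventually_elim
      case (elim n)
      have "covered (D n) (L n + z) \<subseteq> {\<omega> \<in> space M. real_of_ereal (T n \<omega>) - L n \<le> z}"
      proof
        fix \<omega> assume \<omega>: "\<omega> \<in> covered (D n) (L n + z)"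
        \<comment> \<open>These bounds make the cover time finite, so that
          \<open>real_of_ereal\<close> preserves its value.\<close>
        have "T n \<omega> \<le> ereal (L n + z)" "0 \<le> T n \<omega>"
          unfolding T_def using \<omega> elim by (auto intro: cover_time_le cover_time_nonneg)
        then have "real_of_ereal (T n \<omega>) \<le> L n + z" by (cases "T n \<omega>") auto
        then show "\<omega> \<in> {\<omega> \<in> space M. real_of_ereal (T n \<omega>) - L n \<le> z}"
          using \<omega> by (simp add: covered_def)
      qed
      then show ?case using elim events by (simp add: cdf finite_measure_mono)
    qed
    fix y b :: real assume "z < y"
    show "eventually (\<lambda>n. cdf (distr M borel (\<lambda>\<omega>. real_of_ereal (T n \<omega>) - L n)) z \<le>
        prob (covered (D n) (L n + y)) + (1 - prob (covered (D n) (L n + b)))) sequentially"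
      using ev[of b]
    proof eventually_elim
      case (elim n)
      have cov: "covered (D n) t \<in> events" for t using assms(4) elim by (intro covered_events) auto
      \<comment> \<open>As \<open>real_of_ereal\<close> sends \<infinity> to 0, outcomes that are
        never covered can belong to the left side. They are absorbed by the complement of
        \<open>covered (D n) (L n + b)\<close>.\<close>
      have "{\<omega> \<in> space M. real_of_ereal (T n \<omega>) - L n \<le> z} \<subseteq>
          covered (D n) (L n + y) \<union> (space M - covered (D n) (L n + b))"
      proof
        fix \<omega> assume \<omega>: "\<omega> \<in> {\<omega> \<in> space M. real_of_ereal (T n \<omega>) - L n \<le> z}"
        show "\<omega> \<in> covered (D n) (L n + y) \<union> (space M - covered (D n) (L n + b))"
        proof (cases "\<omega> \<in> covered (D n) (L n + b)")
          case True
          have "T n \<omega> \<le> ereal (L n + b)" "0 \<le> T n \<omega>"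
            unfolding T_def using True elim by (auto intro: cover_time_le cover_time_nonneg)
          then have "T n \<omega> < ereal (L n + y)" using \<omega> \<open>z < y\<close> by (cases "T n \<omega>") auto
          then obtain t where "ereal t < ereal (L n + y)" "\<omega> \<in> covered (D n) t"
            unfolding T_def using \<omega> cover_time_less_iff[of \<omega>] by auto
          then show ?thesis using covered_mono[of t "L n + y" "D n"] by auto
        qed (use \<omega> in auto)
      qed
      then have "prob {\<omega> \<in> space M. real_of_ereal (T n \<omega>) - L n \<le> z} \<le>
          prob (covered (D n) (L n + y) \<union> (space M - covered (D n) (L n + b)))"
        using cov by (intro finite_measure_mono) auto
      also have "\<dots> \<le> prob (covered (D n) (L n + y)) + prob (space M - covered (D n) (L n + b))"
        using cov by (intro measure_Un_le) auto
      finally show ?case using elim cov by (simp add: cdf prob_compl)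
    qed
  qed
  then show ?thesis
    unfolding weak_conv_m_def weak_conv_def cdf_gumbel T_def L_def G_def by blast
qed

end
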